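(* The six unitals $\mathbb{WU}^\flat$, $\mathbb{WU}^\natural$, $\mathbb{OU}^\flat$, $\mathbb{OU}^\natural$, $\mathbb{PU}^\flat$, $\mathbb{PU}^\natural$ of order $8$ are pairwise non-isomorphic.
   Context: Unitals and closures: A unital of order $n$ is a $2$-$(n^3+1,n+1,1)$ design. All incidence structures here have blocks that are sets of points, and an isomorphism is a bijection of point sets inducing a bijection of block sets. Field and matrices: $\mathbb F_8^\times=\langle z\rangle$ with $z^3=z+1$. Write $[a,b;c,d]$ for the $2\times2$ matrix with rows $(a,b)$ and $(c,d)$; $\mathbb 1=[1,0;0,1]$; $f=[0,1;1,0]$; $g=[z^2,z^4;z^4,z]$; $C=\langle g\rangle\le\mathrm{SL}(2,8)$ (cyclic of order $9$). $\varphi$ is the Frobenius map $x\mapsto x^2$ of $\mathbb F_8$ applied entrywise to matrices, and $D\cdot\varphi$ is the image of a set $D$ of matrices. For a subset $D$ and an element $x$ of $\mathrm{SL}(2,8)$, $D^x=x^{-1}Dx$. Let $\mathfrak P$ be the set of the $9$ Sylow $2$-subgroups of $\mathrm{SL}(2,8)$ (each of order $8$). For a set $\mathcal D$ of $9$-element subsets of $\mathrm{SL}(2,8)$, $\mathbb U_{C,\mathcal D}$ denotes the incidence structure with point set $\mathrm{SL}(2,8)$ and block set $\{Cx\mid x\in \mathrm{SL}(2,8)\}\cup\{Tx\mid T\in\mathfrak P,\ x\in \mathrm{SL}(2,8)\}\cup\{Dx\mid D\in\mathcal D,\ x\in \mathrm{SL}(2,8)\}$, incidence being containment. The following three are affine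 unitals of order $8$: $\mathbb{WU}=\mathbb U_{C,\{D_1,\dots,D_6\}}$ with $D_1=\{\mathbb 1,[z^5,1;z^5,z^6],[z^4,z^2;1,z^2],[0,z;z^6,z^2],[1,z^4;z^2,z^2],[1,z;z^6,0],[1,z^2;1,z^6],[z^4,1;z^5,1],[z^5,0;0,z^2]\}$, $D_2=D_1\cdot\varphi$, $D_3=D_1\cdot\varphi^2$, $D_4=\{\mathbb 1,[z^5,0;z^6,z^2],[z,z^6;z^4,1],[0,z;z^6,z^5],[z^4,0;z^2,z^3],[z^5,z^2;z^3,z^6],[0,z^2;z^5,z^5],[0,z^4;z^3,z^4],[z^2,z^5;z^5,z^6]\}$, $D_5=D_4\cdot\varphi$, $D_6=D_4\cdot\varphi^2$. $\mathbb{OU}=\mathbb U_{C,\{E_1,\dots,E_6\}}$ with $E_1=\{\mathbb 1,[z^5,1;z^5,z^6],[z^4,z^2;1,z^2],[1,z;z^6,0],[0,z;z^6,z^2],[1,z^4;z^2,z^2],[z^3,z^5;z^3,1],[z^5,z^4;z^2,z^4],[z^2,0;0,z^5]\}$, $E_2=E_1^g$, $E_3=E_1^{g^2}$, $E_4=\{\mathbb 1,[z^5,0;z^6,z^2],[z,z^6;z^4,1],[z^5,z^2;z^5,0],[z^3,z^4;z^6,z^5],[1,1;z^3,z],[1,z;1,z^3],[z,z^2;1,z^5],[z,0;z,z^6]\}$, $E_5=E_4^g$, $E_6=E_4^{g^2}$. $\mathbb{PU}=\mathbb U_{C,\{E_1',\dots,E_6'\}}$ with $E_1'=E_1$, $E_2'=E_2$,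 $E_3'=E_3$, $E_4'=E_4^f$, $E_5'=(E_4')^g$, $E_6'=(E_4')^{g^2}$. In each of these, the short blocks (those with $8$ points) are the right cosets $Tx$, $T\in\mathfrak P$; the set of these coincides with the set of all left cosets $xT$, $T\in\mathfrak P$. A parallelism is a partition of the set of short blocks into $9$ parallel classes of $63$ pairwise non-intersecting short blocks. Two parallelisms are $\flat=\{\{Tx\mid x\in\mathrm{SL}(2,8)\}\mid T\in\mathfrak P\}$ and $\natural=\{\{xT\mid x\in\mathrm{SL}(2,8)\}\mid T\in\mathfrak P\}$. For $\mathbb U$ one of the three structures and a parallelism $\pi$, the closure $\mathbb U^\pi$ is the unital of order $8$ obtained by adding, for each parallel class of $\pi$, a new point incident with exactly the short blocks of that class, and then one new block $[\infty]$ incident with exactly the $9$ new points. *)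

theory Defs
  imports "HOL-Analysis.Analysis" "HOL-Algebra.Algebra"
begin

record 'p incidence =
  points :: "'p set"
  blocks :: "'p set set"

definition isomorphic :: "'p incidence \<Rightarrow> 'q incidence \<Rightarrow> bool" where
  "isomorphic U V \<longleftrightarrow>
     (\<exists>f. bij_betw f (points U) (points V) \<and> bij_betw ((`) f) (blocks U) (blocks V))"

text \<open>The closure with respect to a parallelism \<open>\<pi>\<close> (a set of parallel classes, each a set of
  blocks). The new points are the parallel classes themselves, tagged \<open>Inr\<close>; the old points
  are tagged \<open>Inl\<close>. A block in no class of \<open>\<pi>\<close> gets no new point.\<close>

definition closure_by :: "'p incidence \<Rightarrow> 'p set set set \<Rightarrow> ('p + 'p set set) incidence" where
  "closure_by U \<pi> =
     \<lparr>points = Inl ` points U \<union> Inr ` \<pi>,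
      blocks = insert (Inr ` \<pi>) ((\<lambda>B. Inl ` B \<union> Inr ` {c \<in> \<pi>. B \<in> c}) ` blocks U)\<rparr>"

definition SL2 :: "('a::field^2^2) monoid" where
  "SL2 = \<lparr>carrier = {A. det A = 1}, mult = (**), one = mat 1\<rparr>"

definition mat2 :: "'a::field \<Rightarrow> 'a \<Rightarrow> 'a \<Rightarrow> 'a \<Rightarrow> 'a^2^2" where
  "mat2 a b c d = vector [vector [a, b], vector [c, d]]"

definition sylow_subgroups :: "nat \<Rightarrow> ('g, 'b) monoid_scheme \<Rightarrow> 'g set set" where
  "sylow_subgroups p G = {T. subgroup T G \<and> card T = p ^ multiplicity p (order G)}"

definition conj_set :: "('g, 'b) monoid_scheme \<Rightarrow> 'g set \<Rightarrow> 'g \<Rightarrow> 'g set" where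
  "conj_set G D x = (inv\<^bsub>G\<^esub> x <#\<^bsub>G\<^esub> D) #>\<^bsub>G\<^esub> x"

definition frobenius :: "('a::field^2^2) set \<Rightarrow> ('a^2^2) set" where
  "frobenius D = map_matrix (\<lambda>x. x ^ 2) ` D"

text \<open>In the following, \<open>'a\<close> is meant to be a field with eight elements and \<open>z\<close> a generator of its
  multiplicative group with \<open>z ^ 3 = z + 1\<close>; these are assumptions of the theorem.\<close>

definition f_mat :: "'a::field^2^2" where
  "f_mat = mat2 0 1 1 0"

definition g_mat :: "'a::field \<Rightarrow> 'a^2^2" where
  "g_mat z = mat2 (z^2) (z^4) (z^4) z"

definition C_sub :: "'a::field \<Rightarrow> ('a^2^2) set" where
  "C_sub z = generate SL2 {g_mat z}"

definition affine_U :: "('a::field^2^2) set \<Rightarrow> ('a^2^2) set set \<Rightarrow> ('a^2^2) incidence" where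
  "affine_U C \<D> =
     \<lparr>points = carrier SL2,
      blocks = {C #>\<^bsub>SL2\<^esub> x | x. x \<in> carrier SL2}
        \<union> {T #>\<^bsub>SL2\<^esub> x | T x. T \<in> sylow_subgroups 2 SL2 \<and> x \<in> carrier SL2}
        \<union> {D #>\<^bsub>SL2\<^esub> x | D x. D \<in> \<D> \<and> x \<in> carrier SL2}\<rparr>"

definition flat_par :: "('a::field^2^2) set set set" where
  "flat_par = {{T #>\<^bsub>SL2\<^esub> x | x. x \<in> carrier SL2} | T. T \<in> sylow_subgroups 2 SL2}"

definition natural_par :: "('a::field^2^2) set set set" where
  "natural_par = {{x <#\<^bsub>SL2\<^esub> T | x. x \<in> carrier SL2} | T. T \<in> sylow_subgroups 2 SL2}"

definition D1 :: "'a::field \<Rightarrow> ('a^2^2) set" where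
  "D1 z = {mat 1, mat2 (z^5) 1 (z^5) (z^6), mat2 (z^4) (z^2) 1 (z^2),
   mat2 0 z (z^6) (z^2), mat2 1 (z^4) (z^2) (z^2), mat2 1 z (z^6) 0,
   mat2 1 (z^2) 1 (z^6), mat2 (z^4) 1 (z^5) 1, mat2 (z^5) 0 0 (z^2)}"

definition D4 :: "'a::field \<Rightarrow> ('a^2^2) set" where
  "D4 z = {mat 1, mat2 (z^5) 0 (z^6) (z^2), mat2 z (z^6) (z^4) 1,
   mat2 0 z (z^6) (z^5), mat2 (z^4) 0 (z^2) (z^3), mat2 (z^5) (z^2) (z^3) (z^6),
   mat2 0 (z^2) (z^5) (z^5), mat2 0 (z^4) (z^3) (z^4), mat2 (z^2) (z^5) (z^5) (z^6)}"

definition E1 :: "'a::field \<Rightarrow> ('a^2^2) set" where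
  "E1 z = {mat 1, mat2 (z^5) 1 (z^5) (z^6), mat2 (z^4) (z^2) 1 (z^2),
   mat2 1 z (z^6) 0, mat2 0 z (z^6) (z^2), mat2 1 (z^4) (z^2) (z^2),
   mat2 (z^3) (z^5) (z^3) 1, mat2 (z^5) (z^4) (z^2) (z^4), mat2 (z^2) 0 0 (z^5)}"

definition E4 :: "'a::field \<Rightarrow> ('a^2^2) set" where
  "E4 z = {mat 1, mat2 (z^5) 0 (z^6) (z^2), mat2 z (z^6) (z^4) 1,
   mat2 (z^5) (z^2) (z^5) 0, mat2 (z^3) (z^4) (z^6) (z^5), mat2 1 1 (z^3) z,
   mat2 1 z 1 (z^3), mat2 z (z^2) 1 (z^5), mat2 z 0 z (z^6)}"

definition E4' :: "'a::field \<Rightarrow> ('a^2^2) set" where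
  "E4' z = conj_set SL2 (E4 z) f_mat"

definition WU :: "'a::field \<Rightarrow> ('a^2^2) incidence" where
  "WU z = affine_U (C_sub z)
     {D1 z, frobenius (D1 z), frobenius (frobenius (D1 z)),
      D4 z, frobenius (D4 z), frobenius (frobenius (D4 z))}"

definition OU :: "'a::field \<Rightarrow> ('a^2^2) incidence" where
  "OU z = affine_U (C_sub z)
     {E1 z, conj_set SL2 (E1 z) (g_mat z), conj_set SL2 (E1 z) (g_mat z [^]\<^bsub>SL2\<^esub> (2::nat)),
      E4 z, conj_set SL2 (E4 z) (g_mat z), conj_set SL2 (E4 z) (g_mat z [^]\<^bsub>SL2\<^esub> (2::nat))}"

definition PU :: "'a::field \<Rightarrow> ('a^2^2) incidence" where
  "PU z = affine_U (C_sub z)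
     {E1 z, conj_set SL2 (E1 z) (g_mat z), conj_set SL2 (E1 z) (g_mat z [^]\<^bsub>SL2\<^esub> (2::nat)),
      E4' z, conj_set SL2 (E4' z) (g_mat z), conj_set SL2 (E4' z) (g_mat z [^]\<^bsub>SL2\<^esub> (2::nat))}"

end

theory Submission
  imports Defs
begin

text \<open>Call \<open>B'\<close> a twin of \<open>B\<close> at a point \<open>p\<close> if both blocks miss \<open>p\<close> and every block through \<open>p\<close>
  that meets \<open>B\<close> also meets \<open>B'\<close>. If \<open>p\<close> is the new point belonging to \<open>T\<close>, then \<open>x \<mapsto> tx\<close>
  (for \<open>\<flat>\<close>) and \<open>x \<mapsto> xt\<close> (for \<open>\<natural>\<close>) with \<open>t \<in> T\<close> fix all short blocks through \<open>p\<close> and permute the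
  short blocks. So every short block off \<open>p\<close> has a twin at \<open>p\<close>. At affine points twins are rare, and
  this singles out \<open>[\<infinity>]\<close> as the only block \<open>L\<close> such that for all \<open>p \<in> L\<close> all blocks which meet \<open>L\<close> and
  miss \<open>p\<close> have twins at \<open>p\<close>. Hence every isomorphism of closures preserves the short blocks.

  For \<open>\<natural>\<close> the maps \<open>x \<mapsto> xt\<close> are automorphisms, so all blocks have twins at all points of
  \<open>[\<infinity>]\<close>; for \<open>\<flat>\<close> this fails. This separates \<open>\<flat>\<close> from \<open>\<natural>\<close>. The three affine unitals are separated by
  the numbers of long blocks through a point \<open>a\<close> without a point that is joined to a point \<open>x\<close>
  by a short block: 13 occurs for \<open>PU\<close> only, and 24 occurs for \<open>WU\<close> but not for \<open>OU\<close>. By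
  transitivity \<open>x = 1\<close> suffices, where ``joined'' means having trace 0.\<close>

section \<open>Isomorphism invariants of incidence structures\<close>

text \<open>\<open>special\<close> only asks about blocks meeting \<open>L\<close>, because for
  \<open>\<flat>\<close> the twins come from left multiplications, which preserve short blocks but
  need not preserve long ones; dropping the restriction gives the property
  \<open>translational\<close>. The absence of twins at affine points concerns thousands of blocks,
  too many to compare pairwise by rewriting. Right translations act transitively on the affine
  points and preserve long and short blocks, so everything is moved to the identity. There a few
  long blocks through 1 pin down a block \<open>B\<close>: any block that misses 1 and meets all of
  them is \<open>B\<close>. Three such \<open>B\<close> per unital are enough, since every kind of
  block has a translate through 1 that meets one of them. The certificates use long blocks only,
  which gain no new points, so that one certificate serves both closures. The trace enters because
  the characteristic equation \<open>m^2 = t m + 1\<close> shows that \<open>m\<close> squares to 1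
  exactly if its trace \<open>t\<close> is 0.\<close>

definition twin :: "'p incidence \<Rightarrow> 'p \<Rightarrow> 'p set \<Rightarrow> bool" where
  "twin I p B \<longleftrightarrow> (\<exists>B'\<in>blocks I. B' \<noteq> B \<and> p \<notin> B' \<and>
     (\<forall>M\<in>blocks I. p \<in> M \<and> M \<inter> B \<noteq> {} \<longrightarrow> M \<inter> B' \<noteq> {}))"

lemma twinE:
  assumes "twin I p B"
  obtains B' where "B' \<in> blocks I" "B' \<noteq> B" "p \<notin> B'"
    "\<And>M. M \<in> blocks I \<Longrightarrow> p \<in> M \<Longrightarrow> M \<inter> B \<noteq> {} \<Longrightarrow> M \<inter> B' \<noteq> {}"
proof -
  from assms have "\<exists>B'. B' \<in> blocks I \<and> B' \<noteq> B \<and> p \<notin> B' \<and>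
     (\<forall>M\<in>blocks I. p \<in> M \<and> M \<inter> B \<noteq> {} \<longrightarrow> M \<inter> B' \<noteq> {})"
    by (simp add: twin_def Bex_def)
  then show thesis
  proof (elim exE conjE)
    fix B' assume "B' \<in> blocks I" "B' \<noteq> B" "p \<notin> B'"
      and meet: "\<forall>M\<in>blocks I. p \<in> M \<and> M \<inter> B \<noteq> {} \<longrightarrow> M \<inter> B' \<noteq> {}"
    then show thesis by (intro that[of B'] meet[rule_format]) simp_all
  qed
qed

definition special :: "'p incidence \<Rightarrow> 'p set \<Rightarrow> bool" where
  "special I L \<longleftrightarrow> L \<in> blocks I \<and>
     (\<forall>p\<in>L. \<forall>B\<in>blocks I. p \<notin> B \<and> B \<inter> L \<noteq> {} \<longrightarrow> twin I p B)"

definition translational :: "'p incidence \<Rightarrow> bool" where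
  "translational I \<longleftrightarrow>
     (\<forall>L. special I L \<longrightarrow> (\<forall>p\<in>L. \<forall>B\<in>blocks I. p \<notin> B \<longrightarrow> twin I p B))"

definition ordinary_points :: "'p incidence \<Rightarrow> 'p set" where
  "ordinary_points I = {p \<in> points I. \<forall>L. special I L \<longrightarrow> p \<notin> L}"

text \<open>In a closure the blocks other than \<open>[\<infinity>]\<close> that meet
  \<open>[\<infinity>]\<close> are the short ones. For affine points this is therefore being joined
  by a short block, in terms that every isomorphism respects.\<close>

definition near :: "'p incidence \<Rightarrow> 'p \<Rightarrow> 'p \<Rightarrow> bool" where
  "near I x b \<longleftrightarrow>
     (\<exists>S\<in>blocks I. x \<in> S \<and> b \<in> S \<and> (\<exists>L. special I L \<and> S \<inter> L \<noteq> {}))"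

definition remote_blocks :: "'p incidence \<Rightarrow> 'p \<Rightarrow> 'p \<Rightarrow> 'p set set" where
  "remote_blocks I x a = {B \<in> blocks I. a \<in> B \<and> (\<forall>L. special I L \<longrightarrow> B \<inter> L = {}) \<and>
     (\<forall>b\<in>B. \<not> near I x b)}"

definition remote_numbers :: "'p incidence \<Rightarrow> nat set" where
  "remote_numbers I = {card (remote_blocks I x a) | x a.
     x \<in> ordinary_points I \<and> a \<in> ordinary_points I}"

text \<open>The map \<open>f\<close> is injective on the points only. Membership, equality and
  disjointness of blocks can be transferred because blocks consist of points, which
  \<open>block_sub\<close> has to state since the record type does not enforce it.\<close>

locale incidence_iso =
  fixes I :: "'p incidence" and J :: "'q incidence" and f :: "'p \<Rightarrow> 'q"
  assumes inj: "inj_on f (points I)"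
    and points_J: "points J = f ` points I"
    and blocks_J: "blocks J = (`) f ` blocks I"
    and block_sub: "\<And>B. B \<in> blocks I \<Longrightarrow> B \<subseteq> points I"
begin

lemma mem_iff: "B \<in> blocks I \<Longrightarrow> p \<in> points I \<Longrightarrow> f p \<in> f ` B \<longleftrightarrow> p \<in> B"
  using inj block_sub by (meson inj_on_image_mem_iff)

lemma eq_iff: "B \<in> blocks I \<Longrightarrow> B' \<in> blocks I \<Longrightarrow> f ` B = f ` B' \<longleftrightarrow> B = B'"
  using inj block_sub by (meson inj_on_image_eq_iff)

lemma disj_iff: "B \<in> blocks I \<Longrightarrow> B' \<in> blocks I \<Longrightarrow> f ` B \<inter> f ` B' = {} \<longleftrightarrow> B \<inter> B' = {}"
  using inj block_sub by (metis inj_on_image_Int image_is_empty)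

lemma twin_iff:
  assumes "p \<in> points I" "B \<in> blocks I"
  shows "twin J (f p) (f ` B) \<longleftrightarrow> twin I p B"
  using assms by (simp add: twin_def blocks_J mem_iff eq_iff disj_iff cong: bex_cong ball_cong)

lemma special_iff:
  assumes "L \<in> blocks I"
  shows "special J (f ` L) \<longleftrightarrow> special I L"
proof -
  have "(\<forall>p\<in>f ` L. \<forall>B\<in>blocks J. p \<notin> B \<and> B \<inter> f ` L \<noteq> {} \<longrightarrow> twin J p B) \<longleftrightarrow>
    (\<forall>p\<in>L. \<forall>B\<in>blocks I. p \<notin> B \<and> B \<inter> L \<noteq> {} \<longrightarrow> twin I p B)"
    using assms block_sub[OF assms]
    by (simp add: blocks_J mem_iff disj_iff twin_iff subset_iff cong: ball_cong)
  then show ?thesis using assms by (auto simp: special_def blocks_J)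
qed

lemma special_J: "special J L' \<longleftrightarrow> (\<exists>L\<in>blocks I. L' = f ` L \<and> special I L)"
  using special_iff by (metis (no_types, lifting) blocks_J imageE special_def)

lemma ex_special_J: "(\<exists>L'. special J L' \<and> P L') \<longleftrightarrow> (\<exists>L. special I L \<and> P (f ` L))"
  using special_J by (metis special_def)

lemma all_special_J: "(\<forall>L'. special J L' \<longrightarrow> P L') \<longleftrightarrow> (\<forall>L. special I L \<longrightarrow> P (f ` L))"
  using special_J by (metis special_def)

lemma special_block: "special I L \<Longrightarrow> L \<in> blocks I"
  by (simp add: special_def)

lemma translational_iff: "translational J \<longleftrightarrow> translational I"
proof -
  have "(\<forall>p\<in>f ` L. \<forall>B\<in>blocks J. p \<notin> B \<longrightarrow> twin J p B) \<longleftrightarrow>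
    (\<forall>p\<in>L. \<forall>B\<in>blocks I. p \<notin> B \<longrightarrow> twin I p B)" if "special I L" for L
    using special_block[OF that] block_sub[OF special_block[OF that]]
    by (simp add: blocks_J mem_iff twin_iff subset_iff cong: ball_cong)
  then show ?thesis by (simp add: translational_def all_special_J)
qed

lemma ordinary_points_J: "ordinary_points J = f ` ordinary_points I"
  using mem_iff special_block by (auto simp: ordinary_points_def points_J all_special_J)

lemma near_iff:
  assumes "x \<in> points I" "b \<in> points I"
  shows "near J (f x) (f b) \<longleftrightarrow> near I x b"
proof -
  have "(\<exists>L. special I L \<and> f ` S \<inter> f ` L \<noteq> {}) \<longleftrightarrow> (\<exists>L. special I L \<and> S \<inter> L \<noteq> {})"
    if "S \<in> blocks I" for S
    using that disj_iff special_block by metis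
  then show ?thesis
    using assms by (simp add: near_def blocks_J ex_special_J mem_iff cong: bex_cong)
qed

lemma remote_blocks_J:
  assumes "x \<in> points I" "a \<in> points I"
  shows "remote_blocks J (f x) (f a) = (`) f ` remote_blocks I x a"
proof -
  have "f ` B \<in> remote_blocks J (f x) (f a) \<longleftrightarrow> B \<in> remote_blocks I x a"
    if B: "B \<in> blocks I" for B
  proof -
    have "(\<forall>L. special I L \<longrightarrow> f ` B \<inter> f ` L = {}) \<longleftrightarrow> (\<forall>L. special I L \<longrightarrow> B \<inter> L = {})"
      using B disj_iff special_block by metis
    moreover have "(\<forall>b\<in>B. \<not> near J (f x) (f b)) \<longleftrightarrow> (\<forall>b\<in>B. \<not> near I x b)"
      using block_sub[OF B] assms near_iff by blast
    ultimately show ?thesis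
      using B assms mem_iff by (simp add: remote_blocks_def blocks_J all_special_J)
  qed
  moreover have "remote_blocks J (f x) (f a) \<subseteq> (`) f ` blocks I" "remote_blocks I x a \<subseteq> blocks I"
    by (auto simp: remote_blocks_def blocks_J)
  ultimately show ?thesis by blast
qed

lemma card_remote_blocks_J:
  assumes "x \<in> points I" "a \<in> points I"
  shows "card (remote_blocks J (f x) (f a)) = card (remote_blocks I x a)"
  unfolding remote_blocks_J[OF assms]
  by (rule card_image) (auto simp: inj_on_def remote_blocks_def eq_iff)

lemma remote_numbers_iff: "remote_numbers J = remote_numbers I"
proof -
  let ?O = "ordinary_points I"
  have eq: "card (remote_blocks J (f x) (f a)) = card (remote_blocks I x a)"
    if "x \<in> ?O" "a \<in> ?O" for x a
    using that card_remote_blocks_J by (simp add: ordinary_points_def)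
  have "remote_numbers J = (\<lambda>(x, a). card (remote_blocks J (f x) (f a))) ` (?O \<times> ?O)"
    unfolding remote_numbers_def ordinary_points_J by force
  also have "\<dots> = (\<lambda>(x, a). card (remote_blocks I x a)) ` (?O \<times> ?O)"
    using eq by (intro image_cong) auto
  also have "\<dots> = remote_numbers I"
    unfolding remote_numbers_def by force
  finally show ?thesis .
qed

end

lemma isomorphic_invariants:
  assumes "isomorphic I J" "\<And>B. B \<in> blocks I \<Longrightarrow> B \<subseteq> points I"
  shows "translational I \<longleftrightarrow> translational J" "remote_numbers I = remote_numbers J"
proof -
  obtain f where "bij_betw f (points I) (points J)" "bij_betw ((`) f) (blocks I) (blocks J)"
    using assms(1) by (auto simp: isomorphic_def)
  then interpret incidence_iso I J f
    using assms(2) by unfold_locales (auto simp: bij_betw_def)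
  show "translational I \<longleftrightarrow> translational J" "remote_numbers I = remote_numbers J"
    using translational_iff remote_numbers_iff by auto
qed

section \<open>Closures with respect to a parallelism\<close>

lemma eq_image_Collect:
  assumes "R \<subseteq> f ` A" "\<And>B. B \<in> A \<Longrightarrow> f B \<in> R \<longleftrightarrow> Q B" "{B. Q B} \<subseteq> A"
  shows "R = f ` {B. Q B}"
  using assms by blast

text \<open>The assumption \<open>no_twin\<close> is phrased so that it survives every closure:
  \<open>B\<close> and the members of \<open>Ls\<close> are long, hence gain no new points, and
  their intersections with other blocks remain affine. A nonempty \<open>Ls\<close> keeps
  \<open>[\<infinity>]\<close>, which meets no long block, from becoming a twin of
  \<open>B\<close>.\<close>

locale parallel_structure =
  fixes P :: "'p set" and LB SB :: "'p set set" and \<pi> :: "'p set set set"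
  assumes LB_sub: "B \<in> LB \<Longrightarrow> B \<subseteq> P" and SB_sub: "B \<in> SB \<Longrightarrow> B \<subseteq> P"
    and LB_SB: "LB \<inter> SB = {}"
    and Union_classes: "\<Union>\<pi> = SB"
    and class_unique: "c \<in> \<pi> \<Longrightarrow> c' \<in> \<pi> \<Longrightarrow> B \<in> c \<Longrightarrow> B \<in> c' \<Longrightarrow> c = c'"
    and short_twin: "c \<in> \<pi> \<Longrightarrow> B \<in> SB \<Longrightarrow> B \<notin> c \<Longrightarrow>
      \<exists>B'\<in>SB. B' \<noteq> B \<and> B' \<notin> c \<and> (\<forall>M\<in>c. M \<inter> B \<noteq> {} \<longrightarrow> M \<inter> B' \<noteq> {})"
    and no_twin: "L \<in> LB \<union> SB \<Longrightarrow> \<exists>p\<in>L. \<exists>B\<in>LB. p \<notin> B \<and> B \<inter> L \<noteq> {} \<and>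
      (\<exists>Ls. Ls \<noteq> {} \<and> Ls \<subseteq> LB \<and> (\<forall>M\<in>Ls. p \<in> M \<and> M \<inter> B \<noteq> {}) \<and>
        (\<forall>B'\<in>LB \<union> SB. p \<notin> B' \<and> (\<forall>M\<in>Ls. M \<inter> B' \<noteq> {}) \<longrightarrow> B' = B))"
begin

definition cb :: "'p set \<Rightarrow> ('p + 'p set set) set" where
  "cb B = Inl ` B \<union> Inr ` {c \<in> \<pi>. B \<in> c}"

abbreviation clos :: "('p + 'p set set) incidence" where
  "clos \<equiv> closure_by \<lparr>points = P, blocks = LB \<union> SB\<rparr> \<pi>"

abbreviation infty :: "('p + 'p set set) set" where
  "infty \<equiv> Inr ` \<pi>"

lemma blocks_clos: "blocks clos = insert infty (cb ` (LB \<union> SB))"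
  by (simp add: closure_by_def cb_def)

lemma cb_block: "B \<in> LB \<union> SB \<Longrightarrow> cb B \<in> blocks clos"
  by (simp add: blocks_clos)

lemma points_clos: "points clos = Inl ` P \<union> infty"
  by (simp add: closure_by_def)

lemma blocks_clos_sub: "B \<in> blocks clos \<Longrightarrow> B \<subseteq> points clos"
  using LB_sub SB_sub by (fastforce simp: blocks_clos points_clos cb_def)

lemma Inl_cb [simp]: "Inl x \<in> cb B \<longleftrightarrow> x \<in> B"
  by (auto simp: cb_def)

lemma Inr_cb [simp]: "Inr c \<in> cb B \<longleftrightarrow> c \<in> \<pi> \<and> B \<in> c"
  by (auto simp: cb_def)

lemma cb_long: "B \<in> LB \<Longrightarrow> cb B = Inl ` B"
  using LB_SB Union_classes by (auto simp: cb_def)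

lemma cb_inj: "cb B = cb B' \<longleftrightarrow> B = B'"
proof
  assume "cb B = cb B'"
  then have "x \<in> B \<longleftrightarrow> x \<in> B'" for x using Inl_cb by metis
  then show "B = B'" by blast
qed simp

lemma cb_Int_infty: "B \<in> LB \<union> SB \<Longrightarrow> cb B \<inter> infty = {} \<longleftrightarrow> B \<in> LB"
  using LB_SB Union_classes by (auto simp: cb_def)

lemma cb_disjoint_long: "B \<in> LB \<Longrightarrow> cb B \<inter> cb B' = {} \<longleftrightarrow> B \<inter> B' = {}"
proof -
  assume "B \<in> LB"
  then have "cb B \<inter> cb B' = Inl ` (B \<inter> B')" by (auto simp: cb_long)
  then show ?thesis by simp
qed

lemma cb_meet:
  assumes "B \<inter> B' \<noteq> {}"
  shows "cb B \<inter> cb B' \<noteq> {}"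
proof -
  obtain x where "x \<in> B" "x \<in> B'" using assms by blast
  then have "Inl x \<in> cb B \<inter> cb B'" by simp
  then show ?thesis by blast
qed

text \<open>By \<open>class_unique\<close> a block of the class \<open>c\<close> has
  \<open>c\<close> as its only new point, and \<open>cb B\<close> does not contain it. A common
  point is therefore affine.\<close>

lemma cb_class_disjoint:
  assumes "c \<in> \<pi>" "M \<in> c" "B \<in> LB \<union> SB" "B \<notin> c"
  shows "cb M \<inter> cb B \<noteq> {} \<longleftrightarrow> M \<inter> B \<noteq> {}"
proof
  assume "cb M \<inter> cb B \<noteq> {}"
  then obtain p where p: "p \<in> cb M" "p \<in> cb B" by blast
  show "M \<inter> B \<noteq> {}"
  proof (cases p)
    case (Inr c')
    with p assms class_unique[of c c' M] show ?thesis by auto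
  qed (use p in auto)
qed (rule cb_meet)

text \<open>The blocks through the new point of \<open>c\<close> are those of \<open>c\<close> and
  \<open>infty\<close>. The hypothesis \<open>short\<close> takes care of the latter:
  \<open>infty\<close> meets \<open>cb B\<close> only if \<open>B\<close> is short, and then it must
  also meet \<open>cb B'\<close>.\<close>

lemma twin_at_class:
  assumes c: "c \<in> \<pi>" and B: "B \<in> LB \<union> SB" "B \<notin> c" and B': "B' \<in> LB \<union> SB" "B' \<noteq> B" "B' \<notin> c"
    and short: "B \<in> SB \<Longrightarrow> B' \<in> SB"
    and meet: "\<And>M. M \<in> c \<Longrightarrow> M \<inter> B \<noteq> {} \<Longrightarrow> M \<inter> B' \<noteq> {}"
  shows "twin clos (Inr c) (cb B)"
proof -
  have "M \<inter> cb B' \<noteq> {}" if M: "M \<in> blocks clos" "Inr c \<in> M" "M \<inter> cb B \<noteq> {}" for M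
  proof (cases "M = infty")
    case True
    with M(3) B(1) have "B \<in> SB" using cb_Int_infty LB_SB by (auto simp: Int_commute)
    then have "B' \<in> SB" by (rule short)
    then show ?thesis using True B'(1) LB_SB cb_Int_infty by (auto simp: Int_commute)
  next
    case False
    with M(1) obtain M' where M': "M = cb M'" by (auto simp: blocks_clos)
    with M(2) have "M' \<in> c" by simp
    then show ?thesis
      using M(3) M' meet cb_class_disjoint c B B' by metis
  qed
  then show ?thesis
    unfolding twin_def using B' c by (intro bexI[of _ "cb B'"]) (auto simp: cb_inj blocks_clos)
qed

lemma special_infty: "special clos infty"
  unfolding special_def
proof (intro conjI ballI impI)
  fix p B assume p: "p \<in> infty" and B: "B \<in> blocks clos" "p \<notin> B \<and> B \<inter> infty \<noteq> {}"
  from p obtain c where c: "p = Inr c" "c \<in> \<pi>" by blast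
  from B p obtain B0 where B0: "B = cb B0" "B0 \<in> LB \<union> SB" by (auto simp: blocks_clos)
  with B(2) cb_Int_infty LB_SB have "B0 \<in> SB" by blast
  moreover have "B0 \<notin> c" using B(2) B0 c by auto
  ultimately obtain B' where "B' \<in> SB" "B' \<noteq> B0" "B' \<notin> c"
    "\<forall>M\<in>c. M \<inter> B0 \<noteq> {} \<longrightarrow> M \<inter> B' \<noteq> {}"
    using short_twin[OF c(2), of B0] by metis
  then show "twin clos p B"
    unfolding c(1) B0(1) by (intro twin_at_class[OF c(2) B0(2) \<open>B0 \<notin> c\<close>, of B']) auto
qed (simp add: blocks_clos)


lemma special_only_infty:
  assumes "special clos L"
  shows "L = infty"
proof (rule ccontr)
  assume "L \<noteq> infty"
  with assms obtain L0 where L0: "L = cb L0" "L0 \<in> LB \<union> SB"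
    by (auto simp: special_def blocks_clos)
  obtain p B where p: "p \<in> L0" and B: "B \<in> LB" "p \<notin> B \<and> B \<inter> L0 \<noteq> {}"
    and ex: "\<exists>Ls. Ls \<noteq> {} \<and> Ls \<subseteq> LB \<and> (\<forall>M\<in>Ls. p \<in> M \<and> M \<inter> B \<noteq> {}) \<and>
      (\<forall>B'\<in>LB \<union> SB. p \<notin> B' \<and> (\<forall>M\<in>Ls. M \<inter> B' \<noteq> {}) \<longrightarrow> B' = B)"
    using no_twin[OF L0(2)] by (elim bexE conjE, intro that) simp_all
  from ex obtain Ls where Ls: "Ls \<noteq> {}" "Ls \<subseteq> LB" "\<forall>M\<in>Ls. p \<in> M \<and> M \<inter> B \<noteq> {}"
    and only: "\<forall>B'\<in>LB \<union> SB. p \<notin> B' \<and> (\<forall>M\<in>Ls. M \<inter> B' \<noteq> {}) \<longrightarrow> B' = B"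
    by (elim exE conjE)
  have all: "\<forall>q\<in>L. \<forall>B\<in>blocks clos. q \<notin> B \<and> B \<inter> L \<noteq> {} \<longrightarrow> twin clos q B"
    using assms by (simp add: special_def)
  have "Inl p \<in> L" "cb B \<in> blocks clos" "Inl p \<notin> cb B" "cb B \<inter> L \<noteq> {}"
    unfolding L0(1) using p B cb_meet[of B L0] cb_block[of B] by simp_all
  then have "twin clos (Inl p) (cb B)" by (intro all[rule_format] conjI)
  then obtain B' where B': "B' \<in> blocks clos" "B' \<noteq> cb B" "Inl p \<notin> B'"
    and meet: "\<And>M. M \<in> blocks clos \<Longrightarrow> Inl p \<in> M \<Longrightarrow> M \<inter> cb B \<noteq> {} \<Longrightarrow> M \<inter> B' \<noteq> {}"
    by (elim twinE) (rule that)
  have m: "cb M \<inter> B' \<noteq> {}" if "M \<in> Ls" for M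
  proof (rule meet)
    show "cb M \<in> blocks clos" using Ls(2) that by (intro cb_block) blast
    show "Inl p \<in> cb M" "cb M \<inter> cb B \<noteq> {}" using Ls(3) that cb_meet by (metis Inl_cb)+
  qed
  show False
  proof (cases "B' = infty")
    case True
    obtain M where "M \<in> Ls" using Ls(1) by blast
    with m Ls(2) True have "M \<in> LB" "cb M \<inter> infty \<noteq> {}" by auto
    then show False using cb_Int_infty[of M] by simp
  next
    case False
    then obtain B1 where B1: "B' = cb B1" "B1 \<in> LB \<union> SB" using B'(1) by (auto simp: blocks_clos)
    have "\<forall>M\<in>Ls. M \<inter> B1 \<noteq> {}"
    proof
      fix M assume "M \<in> Ls"
      with m Ls(2) B1(1) have "M \<in> LB" "cb M \<inter> cb B1 \<noteq> {}" by auto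
      then show "M \<inter> B1 \<noteq> {}" using cb_disjoint_long[of M B1] by simp
    qed
    then have "B1 = B" using B'(3) B1 only by auto
    then show False using B1 B'(2) by simp
  qed
qed

lemma special_iff_infty: "special clos L \<longleftrightarrow> L = infty"
  using special_infty special_only_infty by blast

lemma ordinary_points_clos: "ordinary_points clos = Inl ` P"
  by (auto simp: ordinary_points_def special_iff_infty points_clos)

lemma near_clos: "near clos (Inl x) (Inl b) \<longleftrightarrow> (\<exists>S\<in>SB. x \<in> S \<and> b \<in> S)"
proof -
  have "(\<exists>S\<in>blocks clos. Inl x \<in> S \<and> Inl b \<in> S \<and> S \<inter> infty \<noteq> {}) \<longleftrightarrow>
    (\<exists>S\<in>LB \<union> SB. x \<in> S \<and> b \<in> S \<and> cb S \<inter> infty \<noteq> {})"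
    by (auto simp: blocks_clos)
  then show ?thesis
    using cb_Int_infty LB_SB by (simp add: near_def special_iff_infty) (metis IntI UnCI UnE empty_iff)
qed

lemma remote_blocks_clos:
  "remote_blocks clos (Inl x) (Inl a) =
     cb ` {B. B \<in> LB \<and> a \<in> B \<and> (\<forall>b\<in>B. \<not> (\<exists>S\<in>SB. x \<in> S \<and> b \<in> S))}"
proof (rule eq_image_Collect)
  show "remote_blocks clos (Inl x) (Inl a) \<subseteq> cb ` (LB \<union> SB)"
  proof
    fix B assume "B \<in> remote_blocks clos (Inl x) (Inl a)"
    then have "B \<in> blocks clos" "B \<inter> infty = {}" "Inl a \<in> B"
      by (simp_all add: remote_blocks_def special_iff_infty)
    then show "B \<in> cb ` (LB \<union> SB)" by (auto simp: blocks_clos)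
  qed
  fix B assume B: "B \<in> LB \<union> SB"
  show "cb B \<in> remote_blocks clos (Inl x) (Inl a) \<longleftrightarrow>
    B \<in> LB \<and> a \<in> B \<and> (\<forall>b\<in>B. \<not> (\<exists>S\<in>SB. x \<in> S \<and> b \<in> S))"
  proof (cases "B \<in> LB")
    case True
    have "(\<forall>q\<in>cb B. \<not> near clos (Inl x) q) \<longleftrightarrow> (\<forall>b\<in>B. \<not> (\<exists>S\<in>SB. x \<in> S \<and> b \<in> S))"
      by (simp add: cb_long[OF True] near_clos)
    moreover have "cb B \<inter> infty = {}" using cb_Int_infty[OF B] True by simp
    ultimately show ?thesis
      using cb_block[OF B] True by (simp add: remote_blocks_def special_iff_infty)
  next
    case False
    then have "cb B \<inter> infty \<noteq> {}" using cb_Int_infty[OF B] by simp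
    then show ?thesis using False by (simp add: remote_blocks_def special_iff_infty)
  qed
qed blast

lemma remote_numbers_clos:
  "remote_numbers clos =
     {card {B \<in> LB. a \<in> B \<and> (\<forall>b\<in>B. \<not> (\<exists>S\<in>SB. x \<in> S \<and> b \<in> S))} | x a. x \<in> P \<and> a \<in> P}"
proof -
  have card: "card (remote_blocks clos (Inl x) (Inl a)) =
    card {B \<in> LB. a \<in> B \<and> (\<forall>b\<in>B. \<not> (\<exists>S\<in>SB. x \<in> S \<and> b \<in> S))}" for x a
    unfolding remote_blocks_clos by (rule card_image) (simp add: inj_on_def cb_inj)
  show ?thesis
    unfolding remote_numbers_def ordinary_points_clos card[symmetric] by blast
qed

lemma translational_clos:
  assumes "\<And>c B. c \<in> \<pi> \<Longrightarrow> B \<in> LB \<union> SB \<Longrightarrow> B \<notin> c \<Longrightarrow>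
    \<exists>B'\<in>LB \<union> SB. B' \<noteq> B \<and> B' \<notin> c \<and> (B \<in> SB \<longrightarrow> B' \<in> SB) \<and>
      (\<forall>M\<in>c. M \<inter> B \<noteq> {} \<longrightarrow> M \<inter> B' \<noteq> {})"
  shows "translational clos"
proof -
  have "twin clos (Inr c) B" if c: "c \<in> \<pi>" and B: "B \<in> blocks clos" "Inr c \<notin> B" for c B
  proof -
    obtain B0 where B0: "B = cb B0" "B0 \<in> LB \<union> SB" using B c by (auto simp: blocks_clos)
    with B c have "B0 \<notin> c" by auto
    then obtain B' where "B' \<in> LB \<union> SB" "B' \<noteq> B0" "B' \<notin> c" "B0 \<in> SB \<longrightarrow> B' \<in> SB"
      "\<forall>M\<in>c. M \<inter> B0 \<noteq> {} \<longrightarrow> M \<inter> B' \<noteq> {}"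
      using assms[OF c B0(2)] by metis
    then show ?thesis unfolding B0(1) by (intro twin_at_class[OF c B0(2) \<open>B0 \<notin> c\<close>, of B']) simp_all
  qed
  then show ?thesis by (auto simp: translational_def special_iff_infty)
qed

text \<open>A twin of \<open>cb B\<close> at the new point of \<open>c\<close> cannot be
  \<open>infty\<close>, which contains that point, so it is \<open>cb B1\<close> with
  \<open>B1\<close> outside \<open>c\<close>. It meets the members of \<open>c\<close> in affine
  points only; hence \<open>B1\<close> meets all of \<open>Ms\<close> and equals
  \<open>B\<close>.\<close>

lemma not_translational_clos:
  assumes c: "c \<in> \<pi>" and B: "B \<in> LB" and Ms: "Ms \<subseteq> c" "\<And>M. M \<in> Ms \<Longrightarrow> M \<inter> B \<noteq> {}"
    and only: "\<And>B'. B' \<in> LB \<union> SB \<Longrightarrow> B' \<notin> c \<Longrightarrow> (\<And>M. M \<in> Ms \<Longrightarrow> M \<inter> B' \<noteq> {}) \<Longrightarrow> B' = B"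
  shows "\<not> translational clos"
proof
  assume "translational clos"
  then have "\<forall>p\<in>infty. \<forall>B\<in>blocks clos. p \<notin> B \<longrightarrow> twin clos p B"
    by (simp add: translational_def special_iff_infty)
  moreover have "Inr c \<notin> cb B" "Inr c \<in> infty" using c by (auto simp: cb_long[OF B])
  moreover have "cb B \<in> blocks clos" using B by (simp add: cb_block)
  ultimately have "twin clos (Inr c) (cb B)" by blast
  then obtain B' where B': "B' \<in> blocks clos" "B' \<noteq> cb B" "Inr c \<notin> B'"
    and meet: "\<And>M. M \<in> blocks clos \<Longrightarrow> Inr c \<in> M \<Longrightarrow> M \<inter> cb B \<noteq> {} \<Longrightarrow> M \<inter> B' \<noteq> {}"
    by (elim twinE) (rule that)
  obtain B1 where B1: "B' = cb B1" "B1 \<in> LB \<union> SB" using B' c by (auto simp: blocks_clos)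
  have "B1 \<notin> c" using B' B1 c by auto
  have "B1 = B"
  proof (rule only)
    fix M assume M: "M \<in> Ms"
    then have "M \<in> c" using Ms by blast
    then have "M \<in> SB" using c Union_classes by blast
    then have "cb M \<inter> B' \<noteq> {}"
      using Ms(2)[OF M] \<open>M \<in> c\<close> c cb_meet cb_block by (intro meet) auto
    then show "M \<inter> B1 \<noteq> {}"
      using cb_class_disjoint c \<open>M \<in> c\<close> B1 \<open>B1 \<notin> c\<close> by metis
  qed fact+
  then show False using B' B1 by simp
qed

end

section \<open>Coset geometries of groups\<close>

lemma (in group) r_coset_Int:
  assumes "A \<subseteq> carrier G" "B \<subseteq> carrier G" "x \<in> carrier G"
  shows "(A #> x) \<inter> (B #> x) = (A \<inter> B) #> x"
proof (intro equalityI subsetI)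
  fix y assume "y \<in> (A #> x) \<inter> (B #> x)"
  then obtain a b where ab: "a \<in> A" "b \<in> B" "y = a \<otimes> x" "y = b \<otimes> x"
    by (auto simp: r_coset_def)
  then have "a = b" using assms r_cancel by (metis subsetD)
  then show "y \<in> (A \<inter> B) #> x" using ab by (auto simp: r_coset_def)
qed (auto simp: r_coset_def)

lemma (in group) r_coset_empty_iff: "A #> x = {} \<longleftrightarrow> A = {}"
  by (auto simp: r_coset_def)

lemma (in group) mem_r_coset_iff:
  assumes "A \<subseteq> carrier G" "x \<in> carrier G" "y \<in> carrier G"
  shows "y \<in> A #> x \<longleftrightarrow> y \<otimes> inv x \<in> A"
proof
  assume "y \<in> A #> x"
  then obtain a where "a \<in> A" "y = a \<otimes> x" by (auto simp: r_coset_def)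
  then show "y \<otimes> inv x \<in> A" using assms by (auto simp: m_assoc subset_iff)
next
  assume "y \<otimes> inv x \<in> A"
  moreover have "y = (y \<otimes> inv x) \<otimes> x" using assms by (simp add: m_assoc)
  ultimately show "y \<in> A #> x" by (auto simp: r_coset_def)
qed

lemma (in group) mem_l_coset_iff:
  assumes "A \<subseteq> carrier G" "x \<in> carrier G" "y \<in> carrier G"
  shows "y \<in> x <# A \<longleftrightarrow> inv x \<otimes> y \<in> A"
proof
  assume "y \<in> x <# A"
  then obtain a where "a \<in> A" "y = x \<otimes> a" by (auto simp: l_coset_def)
  then show "inv x \<otimes> y \<in> A" using assms by (auto simp: m_assoc[symmetric] subset_iff)
next
  assume "inv x \<otimes> y \<in> A"
  moreover have "y = x \<otimes> (inv x \<otimes> y)" using assms by (simp add: m_assoc[symmetric])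
  ultimately show "y \<in> x <# A" by (auto simp: l_coset_def)
qed

lemma (in group) r_coset_subgroup_eq:
  assumes "subgroup H G" "x \<in> carrier G" "y \<in> H #> x"
  shows "H #> y = H #> x"
  using assms repr_independence subgroup.subset by (metis is_group)

lemma (in group) l_coset_subgroup_eq:
  assumes "subgroup H G" "x \<in> carrier G" "y \<in> x <# H"
  shows "y <# H = x <# H"
  using assms l_repr_independence by metis

lemma (in group) r_coset_determines_subgroup:
  assumes "subgroup H G" "subgroup K G" "x \<in> carrier G" "y \<in> carrier G" "H #> x = K #> y"
  shows "H = K"
proof -
  have "x \<in> K #> y" using assms by (metis rcos_self)
  then have "K #> x = K #> y" using assms r_coset_subgroup_eq by blast
  then have e: "H #> x = K #> x" using assms by simp
  have "H = (H #> x) #> inv x" "K = (K #> x) #> inv x"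
    using assms(1-3) by (simp_all add: coset_mult_assoc subgroup.subset coset_mult_one)
  then show ?thesis using e by simp
qed

lemma (in group) l_coset_determines_subgroup:
  assumes "subgroup H G" "subgroup K G" "x \<in> carrier G" "y \<in> carrier G" "x <# H = y <# K"
  shows "H = K"
proof -
  have "x \<in> x <# H" using assms subgroup.one_closed by (force simp: l_coset_def)
  then have "x <# K = y <# K" using assms l_coset_subgroup_eq by blast
  then have e: "x <# H = x <# K" using assms by simp
  have "H = inv x <# (x <# H)" "K = inv x <# (x <# K)"
    using assms(1-3) by (simp_all add: lcos_m_assoc subgroup.subset lcos_mult_one)
  then show ?thesis using e by simp
qed

lemma (in group) r_coset_l_coset_conj:
  assumes "H \<subseteq> carrier G" "x \<in> carrier G"
  shows "(x <# H #> inv x) #> x = x <# H" and "x <# (inv x <# H #> x) = H #> x"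
  using assms
  by (simp_all add: coset_mult_assoc l_coset_subset_G coset_mult_one
      coset_assoc lcos_m_assoc r_coset_subset_G lcos_mult_one)

text \<open>Closure under conjugation makes the left cosets of members of \<open>\<T>\<close> the
  same sets as the right cosets. Since \<open>inv d \<otimes> d' \<in> T\<close> means
  \<open>d' \<in> d <# T\<close>, the assumption \<open>base_quot\<close> says that two points of a
  base are never joined by a short block.\<close>

locale coset_geometry = group G for G (structure) +
  fixes bases :: "'a set set" and \<T> :: "'a set set"
  assumes T_sub: "T \<in> \<T> \<Longrightarrow> subgroup T G"
    and T_fin: "T \<in> \<T> \<Longrightarrow> finite T"
    and T_card: "T \<in> \<T> \<Longrightarrow> T' \<in> \<T> \<Longrightarrow> card T = card T'"
    and T_conj: "T \<in> \<T> \<Longrightarrow> x \<in> carrier G \<Longrightarrow> x <# T #> inv x \<in> \<T>"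
    and T_nontriv: "T \<in> \<T> \<Longrightarrow> \<exists>t\<in>T. t \<noteq> \<one>"
    and base_sub: "D \<in> bases \<Longrightarrow> D \<subseteq> carrier G"
    and base_two: "D \<in> bases \<Longrightarrow> \<exists>d\<in>D. \<exists>d'\<in>D. d \<noteq> d'"
    and base_quot: "D \<in> bases \<Longrightarrow> d \<in> D \<Longrightarrow> d' \<in> D \<Longrightarrow> T \<in> \<T> \<Longrightarrow> inv d \<otimes> d' \<in> T \<Longrightarrow> d = d'"
begin

definition long_blocks :: "'a set set" where
  "long_blocks = {D #> x | D x. D \<in> bases \<and> x \<in> carrier G}"

definition short_blocks :: "'a set set" where
  "short_blocks = {T #> x | T x. T \<in> \<T> \<and> x \<in> carrier G}"

definition flat_classes :: "'a set set set" where
  "flat_classes = {{T #> x | x. x \<in> carrier G} | T. T \<in> \<T>}"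

definition natural_classes :: "'a set set set" where
  "natural_classes = {{x <# T | x. x \<in> carrier G} | T. T \<in> \<T>}"

lemma long_blockI: "D \<in> bases \<Longrightarrow> x \<in> carrier G \<Longrightarrow> D #> x \<in> long_blocks"
  unfolding long_blocks_def by blast

lemma long_blockE:
  assumes "B \<in> long_blocks"
  obtains D x where "D \<in> bases" "x \<in> carrier G" "B = D #> x"
  using assms unfolding long_blocks_def by blast

lemma short_blockI: "T \<in> \<T> \<Longrightarrow> x \<in> carrier G \<Longrightarrow> T #> x \<in> short_blocks"
  unfolding short_blocks_def by blast

lemma short_blockE:
  assumes "B \<in> short_blocks"
  obtains T x where "T \<in> \<T>" "x \<in> carrier G" "B = T #> x"
  using assms unfolding short_blocks_def by blast

lemma T_carrier: "T \<in> \<T> \<Longrightarrow> T \<subseteq> carrier G"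
  using T_sub subgroup.subset by blast

lemma T_conj': "T \<in> \<T> \<Longrightarrow> x \<in> carrier G \<Longrightarrow> inv x <# T #> x \<in> \<T>"
  using T_conj[of T "inv x"] by simp

lemma long_sub: "B \<in> long_blocks \<Longrightarrow> B \<subseteq> carrier G"
  using base_sub r_coset_subset_G by (metis long_blockE)

lemma short_sub: "B \<in> short_blocks \<Longrightarrow> B \<subseteq> carrier G"
  using T_carrier r_coset_subset_G by (metis short_blockE)

lemma block_sub: "B \<in> long_blocks \<union> short_blocks \<Longrightarrow> B \<subseteq> carrier G"
  using long_sub short_sub by blast

lemma long_translate:
  assumes "B \<in> long_blocks" "y \<in> carrier G"
  shows "B #> y \<in> long_blocks"
proof -
  obtain D x where *: "D \<in> bases" "x \<in> carrier G" "B = D #> x"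
    using assms(1) by (rule long_blockE)
  then have "B #> y = D #> (x \<otimes> y)"
    using assms(2) base_sub coset_mult_assoc by simp
  then show ?thesis using * assms(2) long_blockI by simp
qed

lemma short_translate:
  assumes "B \<in> short_blocks" "y \<in> carrier G"
  shows "B #> y \<in> short_blocks"
proof -
  obtain T x where *: "T \<in> \<T>" "x \<in> carrier G" "B = T #> x"
    using assms(1) by (rule short_blockE)
  then have "B #> y = T #> (x \<otimes> y)"
    using assms(2) T_carrier coset_mult_assoc by simp
  then show ?thesis using * assms(2) short_blockI by simp
qed

lemma translate_inverse:
  "B \<subseteq> carrier G \<Longrightarrow> y \<in> carrier G \<Longrightarrow> (B #> y) #> inv y = B"
  "B \<subseteq> carrier G \<Longrightarrow> y \<in> carrier G \<Longrightarrow> (B #> inv y) #> y = B"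
  by (simp_all add: coset_mult_assoc coset_mult_one)

lemma short_blocks_left: "short_blocks = {x <# T | T x. T \<in> \<T> \<and> x \<in> carrier G}"
proof (intro equalityI subsetI)
  fix B assume "B \<in> short_blocks"
  then obtain T x where T: "T \<in> \<T>" "x \<in> carrier G" "B = T #> x" by (rule short_blockE)
  then have "B = x <# (inv x <# T #> x)" using r_coset_l_coset_conj(2) T_carrier by metis
  then show "B \<in> {x <# T | T x. T \<in> \<T> \<and> x \<in> carrier G}" using T T_conj' by blast
next
  fix B assume "B \<in> {x <# T | T x. T \<in> \<T> \<and> x \<in> carrier G}"
  then obtain T x where T: "T \<in> \<T>" "x \<in> carrier G" "B = x <# T" by blast
  then have "B = (x <# T #> inv x) #> x" using r_coset_l_coset_conj(1) T_carrier by metis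
  then show "B \<in> short_blocks" using T T_conj short_blockI by metis
qed

lemma left_translate_short:
  assumes "B \<in> short_blocks" "t \<in> carrier G"
  shows "t <# B \<in> short_blocks"
proof -
  obtain T x where T: "T \<in> \<T>" "x \<in> carrier G" "B = x <# T"
    using assms(1) unfolding short_blocks_left by blast
  then have "t <# B = (t \<otimes> x) <# T" using assms T_carrier by (simp add: lcos_m_assoc)
  then show ?thesis using T assms(2) unfolding short_blocks_left by blast
qed

lemma base_quot_right:
  assumes "D \<in> bases" "d \<in> D" "d' \<in> D" "T \<in> \<T>" "d' \<otimes> inv d \<in> T"
  shows "d = d'"
proof -
  have c: "d \<in> carrier G" "d' \<in> carrier G" using assms base_sub by blast+
  have "inv d \<otimes> d' = inv d \<otimes> (d' \<otimes> inv d) \<otimes> d" using c by (simp add: m_assoc)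
  then have "inv d \<otimes> d' \<in> inv d <# T #> d"
    using assms(5) by (auto simp: l_coset_def r_coset_def)
  then show ?thesis using assms c T_conj' base_quot by blast
qed

text \<open>Two points \<open>d x\<close> and \<open>d' x\<close> of a right coset of
  \<open>T\<close> have the quotient \<open>d' \<otimes> inv d\<close> in \<open>T\<close>, so a
  base whose translate is short would have only one element by
  \<open>base_quot_right\<close>.\<close>

lemma long_short_disjoint: "long_blocks \<inter> short_blocks = {}"
proof (rule ccontr)
  assume "long_blocks \<inter> short_blocks \<noteq> {}"
  then obtain D x T y where D: "D \<in> bases" "x \<in> carrier G" and T: "T \<in> \<T>" "y \<in> carrier G"
    and eq: "D #> x = T #> y"
    by (metis IntE ex_in_conv long_blockE short_blockE)
  obtain d d' where d: "d \<in> D" "d' \<in> D" "d \<noteq> d'" using base_two D by blast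
  have c: "d \<in> carrier G" "d' \<in> carrier G" using d D base_sub by blast+
  have "d \<otimes> x \<in> T #> y" "d' \<otimes> x \<in> T #> y" using d eq by (auto simp: r_coset_def)
  then have "d \<otimes> x \<otimes> inv y \<in> T" "d' \<otimes> x \<otimes> inv y \<in> T"
    using mem_r_coset_iff T T_carrier D c by auto
  then have "(d' \<otimes> x \<otimes> inv y) \<otimes> inv (d \<otimes> x \<otimes> inv y) \<in> T"
    using T T_sub subgroup.m_closed subgroup.m_inv_closed by metis
  moreover have "(d' \<otimes> x \<otimes> inv y) \<otimes> inv (d \<otimes> x \<otimes> inv y) = d' \<otimes> inv d"
  proof -
    define u where "u = x \<otimes> inv y"
    have u: "u \<in> carrier G" using D T by (simp add: u_def)
    have "(d' \<otimes> u) \<otimes> inv (d \<otimes> u) = d' \<otimes> (u \<otimes> inv u) \<otimes> inv d"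
      using c u by (simp only: inv_mult_group m_assoc inv_closed m_closed)
    then show ?thesis using c u D T by (simp add: u_def m_assoc)
  qed
  ultimately show False using base_quot_right D d T by metis
qed

lemma Union_flat: "\<Union>flat_classes = short_blocks"
  by (auto simp: flat_classes_def short_blocks_def)

lemma Union_natural: "\<Union>natural_classes = short_blocks"
  unfolding short_blocks_left by (auto simp: natural_classes_def)

lemma flat_class_unique:
  assumes "c \<in> flat_classes" "c' \<in> flat_classes" "B \<in> c" "B \<in> c'"
  shows "c = c'"
proof -
  obtain T T' x y where "T \<in> \<T>" "T' \<in> \<T>" "c = {T #> x | x. x \<in> carrier G}"
    "c' = {T' #> x | x. x \<in> carrier G}" "x \<in> carrier G" "y \<in> carrier G" "B = T #> x" "B = T' #> y"
    using assms by (auto simp: flat_classes_def)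
  moreover from this have "T = T'" using r_coset_determines_subgroup T_sub by metis
  ultimately show ?thesis by simp
qed

lemma natural_class_unique:
  assumes "c \<in> natural_classes" "c' \<in> natural_classes" "B \<in> c" "B \<in> c'"
  shows "c = c'"
proof -
  obtain T T' x y where "T \<in> \<T>" "T' \<in> \<T>" "c = {x <# T | x. x \<in> carrier G}"
    "c' = {x <# T' | x. x \<in> carrier G}" "x \<in> carrier G" "y \<in> carrier G" "B = x <# T" "B = y <# T'"
    using assms by (auto simp: natural_classes_def)
  moreover from this have "T = T'" using l_coset_determines_subgroup T_sub by metis
  ultimately show ?thesis by simp
qed

text \<open>Members of \<open>\<T>\<close> have equal finite size, so inclusion would force
  equality.\<close>

lemma obtain_outside:
  assumes "T \<in> \<T>" "T' \<in> \<T>" "T' \<noteq> T"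
  obtains t where "t \<in> T" "t \<notin> T'" "t \<in> carrier G"
  using assms T_card T_fin T_carrier card_subset_eq by (metis subsetD subsetI)

text \<open>The set \<open>t <# B\<close> is short again because short blocks are left cosets as
  well. It differs from \<open>B = T' #> y\<close> as soon as \<open>t\<close> lies outside
  \<open>T'\<close>, and it stays outside the class since left multiplication by \<open>t\<close>
  fixes every member of the class.\<close>

lemma flat_twin:
  assumes c: "c \<in> flat_classes" and B: "B \<in> short_blocks" "B \<notin> c"
  shows "\<exists>B'\<in>short_blocks. B' \<noteq> B \<and> B' \<notin> c \<and> (\<forall>M\<in>c. M \<inter> B \<noteq> {} \<longrightarrow> M \<inter> B' \<noteq> {})"
proof -
  obtain T where T: "T \<in> \<T>" and c_eq: "c = {T #> x | x. x \<in> carrier G}"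
    using c by (auto simp: flat_classes_def)
  obtain T' y where T': "T' \<in> \<T>" "y \<in> carrier G" "B = T' #> y"
    using B(1) by (rule short_blockE)
  have "T' \<noteq> T" using B T' c_eq by blast
  then obtain t where t: "t \<in> T" "t \<notin> T'" "t \<in> carrier G" using obtain_outside T T' by metis
  have Bc: "B \<subseteq> carrier G" using B short_sub by blast
  show ?thesis
  proof (intro bexI[of _ "t <# B"] conjI ballI impI)
    show "t <# B \<in> short_blocks" using left_translate_short B t by blast
    have "y \<in> B" using T' T_sub rcos_self by metis
    then have "t \<otimes> y \<in> t <# B" by (auto simp: l_coset_def)
    moreover have "t \<otimes> y \<notin> B"
      using t T' T_carrier by (simp add: mem_r_coset_iff m_assoc)
    ultimately show "t <# B \<noteq> B" by blast
    show "t <# B \<notin> c"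
    proof
      assume "t <# B \<in> c"
      then obtain w where w: "w \<in> carrier G" "t <# B = T #> w" using c_eq by blast
      have "inv t <# T = T"
        using T t T_sub by (metis coset_join3 inv_closed subgroup.m_inv_closed)
      have "B = inv t <# (t <# B)" using Bc t by (simp add: lcos_m_assoc lcos_mult_one)
      also have "\<dots> = (inv t <# T) #> w" using w t T T_carrier by (simp add: coset_assoc)
      also have "\<dots> = T #> w" using \<open>inv t <# T = T\<close> by simp
      finally show False using B w c_eq by blast
    qed
    fix M assume M: "M \<in> c" "M \<inter> B \<noteq> {}"
    then obtain w b where w: "w \<in> carrier G" "M = T #> w" "b \<in> M" "b \<in> B" using c_eq by blast
    then have "t \<otimes> b \<in> M"
      using Bc T t T_sub T_carrier by (auto simp: mem_r_coset_iff m_assoc subgroup.m_closed subset_iff)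
    moreover have "t \<otimes> b \<in> t <# B" using w by (auto simp: l_coset_def)
    ultimately show "M \<inter> (t <# B) \<noteq> {}" by blast
  qed
qed

text \<open>The point to settle is that some \<open>t \<in> T\<close> moves \<open>B\<close>. For a
  short block \<open>y <# T'\<close> any \<open>t\<close> outside \<open>T'\<close> does. For a long
  block \<open>D #> x\<close> any \<open>t\<close> other than the identity does: if
  \<open>d x t = d' x\<close> with \<open>d'\<close> in \<open>D\<close>, then
  \<open>inv d \<otimes> d' = x t (inv x)\<close> lies in a conjugate of \<open>T\<close>, and
  \<open>base_quot\<close> gives \<open>d = d'\<close>, hence \<open>t = \<one>\<close>.\<close>

lemma natural_twin:
  assumes c: "c \<in> natural_classes" and B: "B \<in> long_blocks \<union> short_blocks" "B \<notin> c"
  shows "\<exists>B'\<in>long_blocks \<union> short_blocks. B' \<noteq> B \<and> B' \<notin> c \<and> (B \<in> short_blocks \<longrightarrow> B' \<in> short_blocks) \<and>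
    (\<forall>M\<in>c. M \<inter> B \<noteq> {} \<longrightarrow> M \<inter> B' \<noteq> {})"
proof -
  obtain T where T: "T \<in> \<T>" and c_eq: "c = {x <# T | x. x \<in> carrier G}"
    using c by (auto simp: natural_classes_def)
  have Bc: "B \<subseteq> carrier G" using B block_sub by blast
  have "\<exists>t\<in>T. \<exists>b\<in>B. b \<otimes> t \<notin> B"
  proof (cases "B \<in> short_blocks")
    case True
    then obtain T' y where T': "T' \<in> \<T>" "y \<in> carrier G" "B = y <# T'"
      unfolding short_blocks_left by blast
    have "T' \<noteq> T" using B T' c_eq by blast
    then obtain t where t: "t \<in> T" "t \<notin> T'" "t \<in> carrier G" using obtain_outside T T' by metis
    have "y \<otimes> t \<notin> B"
      using t T' T_carrier by (simp add: mem_l_coset_iff m_assoc[symmetric])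
    moreover have "y \<in> B" using T' T_sub subgroup.one_closed by (force simp: l_coset_def)
    ultimately show ?thesis using t by blast
  next
    case False
    then obtain D x where D: "D \<in> bases" "x \<in> carrier G" "B = D #> x"
      using B long_blockE by (metis UnE)
    obtain t where t: "t \<in> T" "t \<noteq> \<one>" using T_nontriv T by blast
    have tc: "t \<in> carrier G" using t T T_carrier by blast
    obtain d where d: "d \<in> D" using base_two D by blast
    have dc: "d \<in> carrier G" using d D base_sub by blast
    have "d \<otimes> x \<otimes> t \<notin> B"
    proof
      assume "d \<otimes> x \<otimes> t \<in> B"
      then have d': "d \<otimes> x \<otimes> t \<otimes> inv x \<in> D"
        using D base_sub mem_r_coset_iff tc dc by auto
      have "inv d \<otimes> (d \<otimes> x \<otimes> t \<otimes> inv x) = x \<otimes> t \<otimes> inv x"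
        using dc tc D by (simp add: m_assoc[symmetric])
      moreover have "x \<otimes> t \<otimes> inv x \<in> x <# T #> inv x"
        using t by (auto simp: l_coset_def r_coset_def)
      ultimately have "d = d \<otimes> x \<otimes> t \<otimes> inv x"
        using base_quot[OF D(1) d d'] T_conj[OF T] D by metis
      then have "d \<otimes> (x \<otimes> t \<otimes> inv x) = d \<otimes> \<one>" using dc tc D by (simp add: m_assoc)
      then have "x \<otimes> t \<otimes> inv x = \<one>" using dc tc D by (metis inv_closed l_cancel m_closed one_closed)
      then have "x \<otimes> t = x" using tc D by (metis inv_equality inv_inv inv_closed m_closed)
      then show False using t tc D by (metis l_cancel_one)
    qed
    moreover have "d \<otimes> x \<in> B" using d D by (auto simp: r_coset_def)
    ultimately show ?thesis using t by blast
  qed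
  then obtain t b where t: "t \<in> T" and b: "b \<in> B" "b \<otimes> t \<notin> B" by blast
  have tc: "t \<in> carrier G" using t T T_carrier by blast
  show ?thesis
  proof (intro bexI[of _ "B #> t"] conjI ballI impI)
    show "B #> t \<in> short_blocks" if "B \<in> short_blocks"
      using that short_translate tc by blast
    show "B #> t \<in> long_blocks \<union> short_blocks" using B short_translate long_translate tc by blast
    have "b \<otimes> t \<in> B #> t" using b by (auto simp: r_coset_def)
    then show "B #> t \<noteq> B" using b by blast
    show "B #> t \<notin> c"
    proof
      assume "B #> t \<in> c"
      then obtain w where w: "w \<in> carrier G" "B #> t = w <# T" using c_eq by blast
      have "T #> inv t = T"
        using T t T_sub by (metis coset_join2 inv_closed subgroup.m_inv_closed tc)
      have "B = (B #> t) #> inv t" using Bc tc translate_inverse by simp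
      also have "\<dots> = w <# (T #> inv t)" using w tc T T_carrier by (simp add: coset_assoc)
      also have "\<dots> = w <# T" using \<open>T #> inv t = T\<close> by simp
      finally show False using B w c_eq by blast
    qed
    fix M assume M: "M \<in> c" "M \<inter> B \<noteq> {}"
    then obtain w b where w: "w \<in> carrier G" "M = w <# T" "b \<in> M" "b \<in> B" using c_eq by blast
    then have "b \<otimes> t \<in> M"
      using Bc T t tc T_sub T_carrier
      by (auto simp: mem_l_coset_iff m_assoc[symmetric] subgroup.m_closed subset_iff)
    moreover have "b \<otimes> t \<in> B #> t" using w by (auto simp: r_coset_def)
    ultimately show "M \<inter> (B #> t) \<noteq> {}" by blast
  qed
qed

end

text \<open>Certificates are required at the identity only. Every block is some
  \<open>L0 #> x\<close>; the translation that moves its point \<open>d x\<close> to 1 turns it into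
  \<open>L0 #> inv d\<close>, and \<open>no_twin\<close> carries the conclusion back. For
  \<open>\<flat>\<close> a single class with a single long block fixed by members of that class is
  enough to refute \<open>translational\<close>.\<close>

locale certified_geometry = coset_geometry G bases \<T> for G (structure) and bases \<T> +
  assumes line_certificate: "L \<in> bases \<union> \<T> \<Longrightarrow>
      \<exists>d\<in>L. \<exists>B\<in>long_blocks. \<one> \<notin> B \<and> B \<inter> (L #> inv d) \<noteq> {} \<and>
        (\<exists>Ls. Ls \<noteq> {} \<and> Ls \<subseteq> long_blocks \<and> (\<forall>M\<in>Ls. \<one> \<in> M \<and> M \<inter> B \<noteq> {}) \<and>
          (\<forall>B'\<in>long_blocks \<union> short_blocks. \<one> \<notin> B' \<and> (\<forall>M\<in>Ls. M \<inter> B' \<noteq> {}) \<longrightarrow> B' = B))"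
    and flat_certificate: "\<exists>T\<in>\<T>. \<exists>B\<in>long_blocks. \<exists>Ms\<subseteq>{T #> x | x. x \<in> carrier G}.
      (\<forall>M\<in>Ms. M \<inter> B \<noteq> {}) \<and>
      (\<forall>B'\<in>long_blocks \<union> short_blocks. B' \<notin> {T #> x | x. x \<in> carrier G} \<and>
        (\<forall>M\<in>Ms. M \<inter> B' \<noteq> {}) \<longrightarrow> B' = B)"
begin

lemma no_twin:
  assumes "L \<in> long_blocks \<union> short_blocks"
  shows "\<exists>p\<in>L. \<exists>B\<in>long_blocks. p \<notin> B \<and> B \<inter> L \<noteq> {} \<and>
      (\<exists>Ls. Ls \<noteq> {} \<and> Ls \<subseteq> long_blocks \<and> (\<forall>M\<in>Ls. p \<in> M \<and> M \<inter> B \<noteq> {}) \<and>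
        (\<forall>B'\<in>long_blocks \<union> short_blocks. p \<notin> B' \<and> (\<forall>M\<in>Ls. M \<inter> B' \<noteq> {}) \<longrightarrow> B' = B))"
proof -
  obtain L0 x where L0: "L0 \<in> bases \<union> \<T>" and x: "x \<in> carrier G" and L: "L = L0 #> x"
    using assms long_blockE short_blockE by (metis UnE UnI1 UnI2)
  have L0c: "L0 \<subseteq> carrier G" using L0 base_sub T_carrier by blast
  obtain d B Ls where d: "d \<in> L0" and B: "B \<in> long_blocks" "\<one> \<notin> B" "B \<inter> (L0 #> inv d) \<noteq> {}"
    and Ls: "Ls \<noteq> {}" "Ls \<subseteq> long_blocks" "\<forall>M\<in>Ls. \<one> \<in> M \<and> M \<inter> B \<noteq> {}"
    and only: "\<forall>B'\<in>long_blocks \<union> short_blocks.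
      \<one> \<notin> B' \<and> (\<forall>M\<in>Ls. M \<inter> B' \<noteq> {}) \<longrightarrow> B' = B"
    using line_certificate[OF L0] by (elim bexE conjE exE) (rule that)
  define p where "p = d \<otimes> x"
  have dc: "d \<in> carrier G" using d L0c by blast
  have p: "p \<in> carrier G" using dc x by (simp add: p_def)
  have one_iff: "p \<in> A #> p \<longleftrightarrow> \<one> \<in> A" if "A \<subseteq> carrier G" for A
    using that p by (simp add: mem_r_coset_iff)
  have meet_iff: "(A #> p) \<inter> (A' #> p) = {} \<longleftrightarrow> A \<inter> A' = {}"
    if "A \<subseteq> carrier G" "A' \<subseteq> carrier G" for A A'
    using that p by (simp add: r_coset_Int r_coset_empty_iff)
  have Bc: "B \<subseteq> carrier G" using B long_sub by blast
  have L_eq: "L = (L0 #> inv d) #> p"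
    using L0c dc x by (simp add: L p_def coset_mult_assoc m_assoc[symmetric])
  show ?thesis
  proof (intro bexI[of _ p] bexI[of _ "B #> p"] conjI exI[of _ "(\<lambda>M. M #> p) ` Ls"])
    show "p \<notin> B #> p" using B one_iff Bc by simp
    show "(B #> p) \<inter> L \<noteq> {}"
      unfolding L_eq using meet_iff Bc L0c dc B r_coset_subset_G by simp
    show "(\<lambda>M. M #> p) ` Ls \<noteq> {}" using Ls by simp
    show "(\<lambda>M. M #> p) ` Ls \<subseteq> long_blocks" using Ls long_translate p by blast
    show "\<forall>M\<in>(\<lambda>M. M #> p) ` Ls. p \<in> M \<and> M \<inter> (B #> p) \<noteq> {}"
      using Ls long_sub one_iff meet_iff Bc by (auto simp: subset_iff)
    show "B #> p \<in> long_blocks" using B long_translate p by blast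
    show "p \<in> L" using d L by (auto simp: p_def r_coset_def)
    show "\<forall>B'\<in>long_blocks \<union> short_blocks.
      p \<notin> B' \<and> (\<forall>M\<in>(\<lambda>M. M #> p) ` Ls. M \<inter> B' \<noteq> {}) \<longrightarrow> B' = B #> p"
    proof (intro ballI impI, elim conjE)
      fix B' assume B': "B' \<in> long_blocks \<union> short_blocks" "p \<notin> B'"
        and meet: "\<forall>M\<in>(\<lambda>M. M #> p) ` Ls. M \<inter> B' \<noteq> {}"
      define B1 where "B1 = B' #> inv p"
      have B1: "B1 \<in> long_blocks \<union> short_blocks"
        using B'(1) p long_translate short_translate unfolding B1_def by (metis UnE UnI1 UnI2 inv_closed)
      then have B1c: "B1 \<subseteq> carrier G" by (rule block_sub)
      have B'_eq: "B' = B1 #> p" using B'(1) block_sub p translate_inverse unfolding B1_def by metis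
      have "\<one> \<notin> B1" using B'(2) B'_eq one_iff B1c by simp
      moreover have "M \<inter> B1 \<noteq> {}" if "M \<in> Ls" for M
      proof -
        have "(M #> p) \<inter> (B1 #> p) \<noteq> {}" using meet that B'_eq by simp
        moreover have "M \<subseteq> carrier G" using that Ls long_sub by blast
        ultimately show ?thesis using meet_iff B1c by simp
      qed
      ultimately have "B1 = B" using only B1 by blast
      then show "B' = B #> p" using B'_eq by simp
    qed
  qed
qed

sublocale flat: parallel_structure "carrier G" long_blocks short_blocks flat_classes
  using long_sub short_sub long_short_disjoint Union_flat flat_class_unique flat_twin no_twin
  by unfold_locales

sublocale natural: parallel_structure "carrier G" long_blocks short_blocks natural_classes
proof unfold_locales
  fix c B assume "c \<in> natural_classes" "B \<in> short_blocks" "B \<notin> c"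
  then show "\<exists>B'\<in>short_blocks. B' \<noteq> B \<and> B' \<notin> c \<and> (\<forall>M\<in>c. M \<inter> B \<noteq> {} \<longrightarrow> M \<inter> B' \<noteq> {})"
    using natural_twin[of c B] by (metis UnI2)
qed (fact long_sub short_sub long_short_disjoint Union_natural natural_class_unique no_twin)+

lemma translational_natural: "translational natural.clos"
  using natural_twin by (rule natural.translational_clos)

lemma not_translational_flat: "\<not> translational flat.clos"
proof -
  obtain T B Ms where "T \<in> \<T>" and B: "B \<in> long_blocks" and Ms: "Ms \<subseteq> {T #> x | x. x \<in> carrier G}"
    "\<forall>M\<in>Ms. M \<inter> B \<noteq> {}"
    and only: "\<forall>B'\<in>long_blocks \<union> short_blocks. B' \<notin> {T #> x | x. x \<in> carrier G} \<and>
        (\<forall>M\<in>Ms. M \<inter> B' \<noteq> {}) \<longrightarrow> B' = B"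
    using flat_certificate by (elim bexE conjE exE) (rule that)
  then have "{T #> x | x. x \<in> carrier G} \<in> flat_classes" by (auto simp: flat_classes_def)
  then show ?thesis
    using B Ms(1)
  proof (rule flat.not_translational_clos)
    fix B' assume "B' \<in> long_blocks \<union> short_blocks" "B' \<notin> {T #> x | x. x \<in> carrier G}"
      "\<And>M. M \<in> Ms \<Longrightarrow> M \<inter> B' \<noteq> {}"
    then show "B' = B" using only by simp
  qed (use Ms in simp)
qed

section \<open>Long blocks without points joined to the identity\<close>

definition remote :: "'a \<Rightarrow> 'a set set" where
  "remote a = {B \<in> long_blocks. a \<in> B \<and> (\<forall>b\<in>B. b \<notin> \<Union>\<T>)}"

lemma joined_iff:
  assumes "x \<in> carrier G" "b \<in> carrier G"
  shows "(\<exists>S\<in>short_blocks. x \<in> S \<and> b \<in> S) \<longleftrightarrow> b \<otimes> inv x \<in> \<Union>\<T>"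
proof
  assume "\<exists>S\<in>short_blocks. x \<in> S \<and> b \<in> S"
  then obtain T y where T: "T \<in> \<T>" "y \<in> carrier G" "x \<in> T #> y" "b \<in> T #> y"
    by (metis short_blockE)
  then have "T #> x = T #> y" using T_sub r_coset_subgroup_eq by metis
  then have "b \<otimes> inv x \<in> T" using T assms mem_r_coset_iff[OF T_carrier] by metis
  then show "b \<otimes> inv x \<in> \<Union>\<T>" using T by blast
next
  assume "b \<otimes> inv x \<in> \<Union>\<T>"
  then obtain T where T: "T \<in> \<T>" "b \<otimes> inv x \<in> T" by blast
  then have "b \<in> T #> x" using assms mem_r_coset_iff[OF T_carrier] by metis
  moreover have "x \<in> T #> x" using T assms T_sub rcos_self by metis
  ultimately show "\<exists>S\<in>short_blocks. x \<in> S \<and> b \<in> S" using short_blockI T assms by blast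
qed

text \<open>Right multiplication by \<open>inv x\<close> preserves long and short blocks and moves
  \<open>x\<close> to the identity.\<close>

lemma card_remote:
  assumes x: "x \<in> carrier G" and a: "a \<in> carrier G"
  shows "card {B \<in> long_blocks. a \<in> B \<and> (\<forall>b\<in>B. \<not> (\<exists>S\<in>short_blocks. x \<in> S \<and> b \<in> S))} =
    card (remote (a \<otimes> inv x))"
proof -
  have "{B \<in> long_blocks. a \<in> B \<and> (\<forall>b\<in>B. \<not> (\<exists>S\<in>short_blocks. x \<in> S \<and> b \<in> S))} =
    (\<lambda>B. B #> x) ` remote (a \<otimes> inv x)" (is "?A = _")
  proof (intro equalityI subsetI)
    fix B assume "B \<in> ?A"
    then have B: "B \<in> long_blocks" "a \<in> B"
      and far: "\<forall>b\<in>B. \<not> (\<exists>S\<in>short_blocks. x \<in> S \<and> b \<in> S)" by simp_all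
    have Bc: "B \<subseteq> carrier G" using B long_sub by blast
    have "\<forall>b\<in>B. b \<otimes> inv x \<notin> \<Union>\<T>"
      using far joined_iff[OF x] Bc by (metis subsetD)
    then have "\<forall>b\<in>B #> inv x. b \<notin> \<Union>\<T>" by (auto simp: r_coset_def simp del: Union_iff)
    moreover have "a \<otimes> inv x \<in> B #> inv x" using B by (auto simp: r_coset_def)
    moreover have "B #> inv x \<in> long_blocks" using B long_translate x by simp
    ultimately have "B #> inv x \<in> remote (a \<otimes> inv x)" unfolding remote_def by blast
    then show "B \<in> (\<lambda>B. B #> x) ` remote (a \<otimes> inv x)"
      using translate_inverse(2)[OF Bc x] by (metis image_eqI)
  next
    fix B assume "B \<in> (\<lambda>B. B #> x) ` remote (a \<otimes> inv x)"
    then obtain B1 where B1: "B = B1 #> x" "B1 \<in> long_blocks" "a \<otimes> inv x \<in> B1"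
      "\<forall>b\<in>B1. b \<notin> \<Union>\<T>" unfolding remote_def by blast
    then have c: "B1 \<subseteq> carrier G" using long_sub by blast
    have "B \<in> long_blocks" using B1 long_translate x by simp
    moreover have "a \<in> B" using B1 c x a by (simp add: mem_r_coset_iff)
    moreover have "\<not> (\<exists>S\<in>short_blocks. x \<in> S \<and> b \<in> S)" if "b \<in> B" for b
    proof -
      have bc: "b \<in> carrier G" using that \<open>B \<in> long_blocks\<close> long_sub by blast
      then have "b \<otimes> inv x \<in> B1" using that B1(1) c x mem_r_coset_iff by simp
      then show ?thesis using B1(4) joined_iff[OF x bc] by simp
    qed
    ultimately show "B \<in> ?A" by simp
  qed
  moreover have "inj_on (\<lambda>B. B #> x) (remote (a \<otimes> inv x))"
  proof (rule inj_on_inverseI)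
    fix B assume "B \<in> remote (a \<otimes> inv x)"
    then have "B \<subseteq> carrier G" using long_sub unfolding remote_def by blast
    then show "(B #> x) #> inv x = B" using translate_inverse(1) x by simp
  qed
  ultimately show ?thesis by (simp add: card_image)
qed

lemma remote_numbers_eq:
  "{card {B \<in> long_blocks. a \<in> B \<and> (\<forall>b\<in>B. \<not> (\<exists>S\<in>short_blocks. x \<in> S \<and> b \<in> S))} | x a.
     x \<in> carrier G \<and> a \<in> carrier G} = (\<lambda>a. card (remote a)) ` carrier G"
proof (intro equalityI subsetI)
  fix n assume "n \<in> (\<lambda>a. card (remote a)) ` carrier G"
  then obtain a where "a \<in> carrier G" "n = card (remote a)" by blast
  then have "n = card {B \<in> long_blocks. a \<in> B \<and>
      (\<forall>b\<in>B. \<not> (\<exists>S\<in>short_blocks. \<one> \<in> S \<and> b \<in> S))}" "a \<in> carrier G"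
    using card_remote[of \<one> a] by simp_all
  then show "n \<in> {card {B \<in> long_blocks. a \<in> B \<and>
      (\<forall>b\<in>B. \<not> (\<exists>S\<in>short_blocks. x \<in> S \<and> b \<in> S))} | x a. x \<in> carrier G \<and> a \<in> carrier G}"
    using one_closed by blast
next
  fix n assume "n \<in> {card {B \<in> long_blocks. a \<in> B \<and>
      (\<forall>b\<in>B. \<not> (\<exists>S\<in>short_blocks. x \<in> S \<and> b \<in> S))} | x a. x \<in> carrier G \<and> a \<in> carrier G}"
  then obtain x a where "x \<in> carrier G" "a \<in> carrier G"
    "n = card {B \<in> long_blocks. a \<in> B \<and> (\<forall>b\<in>B. \<not> (\<exists>S\<in>short_blocks. x \<in> S \<and> b \<in> S))}"
    by blast
  then show "n \<in> (\<lambda>a. card (remote a)) ` carrier G" using card_remote by simp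
qed

lemma remote_numbers:
  "remote_numbers flat.clos = (\<lambda>a. card (remote a)) ` carrier G"
  "remote_numbers natural.clos = (\<lambda>a. card (remote a)) ` carrier G"
  unfolding flat.remote_numbers_clos natural.remote_numbers_clos by (rule remote_numbers_eq)+

end

section \<open>Computation in the field with eight elements\<close>

text \<open>\<open>F\<^sub>n\<close> stands for \<open>b\<^sub>2 z\<^sup>2 + b\<^sub>1 z + b\<^sub>0\<close> where \<open>b\<^sub>2 b\<^sub>1 b\<^sub>0\<close> are the binary digits of \<open>n\<close>.\<close>

datatype gf8 = F0 | F1 | F2 | F3 | F4 | F5 | F6 | F7

fun gadd :: "gf8 \<Rightarrow> gf8 \<Rightarrow> gf8" where
  "gadd F0 F0 = F0" | "gadd F0 F1 = F1" | "gadd F0 F2 = F2" | "gadd F0 F3 = F3"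
| "gadd F0 F4 = F4" | "gadd F0 F5 = F5" | "gadd F0 F6 = F6" | "gadd F0 F7 = F7"
| "gadd F1 F0 = F1" | "gadd F1 F1 = F0" | "gadd F1 F2 = F3" | "gadd F1 F3 = F2"
| "gadd F1 F4 = F5" | "gadd F1 F5 = F4" | "gadd F1 F6 = F7" | "gadd F1 F7 = F6"
| "gadd F2 F0 = F2" | "gadd F2 F1 = F3" | "gadd F2 F2 = F0" | "gadd F2 F3 = F1"
| "gadd F2 F4 = F6" | "gadd F2 F5 = F7" | "gadd F2 F6 = F4" | "gadd F2 F7 = F5"
| "gadd F3 F0 = F3" | "gadd F3 F1 = F2" | "gadd F3 F2 = F1" | "gadd F3 F3 = F0"
| "gadd F3 F4 = F7" | "gadd F3 F5 = F6" | "gadd F3 F6 = F5" | "gadd F3 F7 = F4"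
| "gadd F4 F0 = F4" | "gadd F4 F1 = F5" | "gadd F4 F2 = F6" | "gadd F4 F3 = F7"
| "gadd F4 F4 = F0" | "gadd F4 F5 = F1" | "gadd F4 F6 = F2" | "gadd F4 F7 = F3"
| "gadd F5 F0 = F5" | "gadd F5 F1 = F4" | "gadd F5 F2 = F7" | "gadd F5 F3 = F6"
| "gadd F5 F4 = F1" | "gadd F5 F5 = F0" | "gadd F5 F6 = F3" | "gadd F5 F7 = F2"
| "gadd F6 F0 = F6" | "gadd F6 F1 = F7" | "gadd F6 F2 = F4" | "gadd F6 F3 = F5"
| "gadd F6 F4 = F2" | "gadd F6 F5 = F3" | "gadd F6 F6 = F0" | "gadd F6 F7 = F1"
| "gadd F7 F0 = F7" | "gadd F7 F1 = F6" | "gadd F7 F2 = F5" | "gadd F7 F3 = F4"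
| "gadd F7 F4 = F3" | "gadd F7 F5 = F2" | "gadd F7 F6 = F1" | "gadd F7 F7 = F0"

fun gmul :: "gf8 \<Rightarrow> gf8 \<Rightarrow> gf8" where
  "gmul F0 F0 = F0" | "gmul F0 F1 = F0" | "gmul F0 F2 = F0" | "gmul F0 F3 = F0"
| "gmul F0 F4 = F0" | "gmul F0 F5 = F0" | "gmul F0 F6 = F0" | "gmul F0 F7 = F0"
| "gmul F1 F0 = F0" | "gmul F1 F1 = F1" | "gmul F1 F2 = F2" | "gmul F1 F3 = F3"
| "gmul F1 F4 = F4" | "gmul F1 F5 = F5" | "gmul F1 F6 = F6" | "gmul F1 F7 = F7"
| "gmul F2 F0 = F0" | "gmul F2 F1 = F2" | "gmul F2 F2 = F4" | "gmul F2 F3 = F6"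
| "gmul F2 F4 = F3" | "gmul F2 F5 = F1" | "gmul F2 F6 = F7" | "gmul F2 F7 = F5"
| "gmul F3 F0 = F0" | "gmul F3 F1 = F3" | "gmul F3 F2 = F6" | "gmul F3 F3 = F5"
| "gmul F3 F4 = F7" | "gmul F3 F5 = F4" | "gmul F3 F6 = F1" | "gmul F3 F7 = F2"
| "gmul F4 F0 = F0" | "gmul F4 F1 = F4" | "gmul F4 F2 = F3" | "gmul F4 F3 = F7"
| "gmul F4 F4 = F6" | "gmul F4 F5 = F2" | "gmul F4 F6 = F5" | "gmul F4 F7 = F1"
| "gmul F5 F0 = F0" | "gmul F5 F1 = F5" | "gmul F5 F2 = F1" | "gmul F5 F3 = F4"
| "gmul F5 F4 = F2" | "gmul F5 F5 = F7" | "gmul F5 F6 = F3" | "gmul F5 F7 = F6"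
| "gmul F6 F0 = F0" | "gmul F6 F1 = F6" | "gmul F6 F2 = F7" | "gmul F6 F3 = F1"
| "gmul F6 F4 = F5" | "gmul F6 F5 = F3" | "gmul F6 F6 = F2" | "gmul F6 F7 = F4"
| "gmul F7 F0 = F0" | "gmul F7 F1 = F7" | "gmul F7 F2 = F5" | "gmul F7 F3 = F2"
| "gmul F7 F4 = F1" | "gmul F7 F5 = F6" | "gmul F7 F6 = F4" | "gmul F7 F7 = F3"

datatype mat = Mat gf8 gf8 gf8 gf8

fun mmul :: "mat \<Rightarrow> mat \<Rightarrow> mat" where
  "mmul (Mat a b c d) (Mat p q r s) =
     Mat (gadd (gmul a p) (gmul b r)) (gadd (gmul a q) (gmul b s))
         (gadd (gmul c p) (gmul d r)) (gadd (gmul c q) (gmul d s))"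

fun mdet :: "mat \<Rightarrow> gf8" where
  "mdet (Mat a b c d) = gadd (gmul a d) (gmul b c)"

fun mtr :: "mat \<Rightarrow> gf8" where
  "mtr (Mat a b c d) = gadd a d"

text \<open>In characteristic 2 the adjugate has no signs; for determinant 1 it is the
  inverse.\<close>

fun minv :: "mat \<Rightarrow> mat" where
  "minv (Mat a b c d) = Mat d b c a"

fun mfrob :: "mat \<Rightarrow> mat" where
  "mfrob (Mat a b c d) = Mat (gmul a a) (gmul b b) (gmul c c) (gmul d d)"

abbreviation one_mat :: mat where
  "one_mat \<equiv> Mat F1 F0 F0 F1"

primrec rtrans :: "mat \<Rightarrow> mat list \<Rightarrow> mat list" where
  "rtrans y [] = []"
| "rtrans y (d # ds) = mmul d y # rtrans y ds"

abbreviation g_con :: mat where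
  "g_con \<equiv> Mat F4 F6 F6 F2"

abbreviation f_con :: mat where
  "f_con \<equiv> Mat F0 F1 F1 F0"

definition mconj :: "mat \<Rightarrow> mat list \<Rightarrow> mat list" where
  "mconj x D = map (\<lambda>d. mmul (mmul (minv x) d) x) D"

text \<open>The entries are the successive powers of \<open>g_con\<close>, from exponent 0 to
  exponent 8.\<close>

definition C_list :: "mat list" where
  "C_list = [Mat F1 F0 F0 F1, Mat F4 F6 F6 F2, Mat F4 F2 F2 F6, Mat F1 F1 F1 F0, Mat F2 F4 F4 F6,
    Mat F6 F4 F4 F2, Mat F0 F1 F1 F1, Mat F6 F2 F2 F4, Mat F2 F6 F6 F4]"

definition D1_list :: "mat list" where
  "D1_list = [Mat F1 F0 F0 F1, Mat F7 F1 F7 F5, Mat F6 F4 F1 F4, Mat F0 F2 F5 F4, Mat F1 F6 F4 F4,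
    Mat F1 F2 F5 F0, Mat F1 F4 F1 F5, Mat F6 F1 F7 F1, Mat F7 F0 F0 F4]"

definition D4_list :: "mat list" where
  "D4_list = [Mat F1 F0 F0 F1, Mat F7 F0 F5 F4, Mat F2 F5 F6 F1, Mat F0 F2 F5 F7, Mat F6 F0 F4 F3,
    Mat F7 F4 F3 F5, Mat F0 F4 F7 F7, Mat F0 F6 F3 F6, Mat F4 F7 F7 F5]"

definition E1_list :: "mat list" where
  "E1_list = [Mat F1 F0 F0 F1, Mat F7 F1 F7 F5, Mat F6 F4 F1 F4, Mat F1 F2 F5 F0, Mat F0 F2 F5 F4,
    Mat F1 F6 F4 F4, Mat F3 F7 F3 F1, Mat F7 F6 F4 F6, Mat F4 F0 F0 F7]"

definition E4_list :: "mat list" where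
  "E4_list = [Mat F1 F0 F0 F1, Mat F7 F0 F5 F4, Mat F2 F5 F6 F1, Mat F7 F4 F7 F0, Mat F3 F6 F5 F7,
    Mat F1 F1 F3 F2, Mat F1 F2 F1 F3, Mat F2 F4 F1 F7, Mat F2 F0 F2 F5]"

text \<open>The \<open>T\<^sub>i\<close> are the stabilizers in \<open>SL(2,8)\<close> of the row vectors \<open>(0,1), (1,0), (1,1), (1,z), \<dots>\<close>.\<close>

definition T0_list :: "mat list" where
  "T0_list = [Mat F1 F0 F0 F1, Mat F1 F1 F0 F1, Mat F1 F2 F0 F1, Mat F1 F3 F0 F1, Mat F1 F4 F0 F1,
    Mat F1 F5 F0 F1, Mat F1 F6 F0 F1, Mat F1 F7 F0 F1]"

definition T1_list :: "mat list" where
  "T1_list = [Mat F1 F0 F0 F1, Mat F1 F0 F1 F1, Mat F1 F0 F2 F1, Mat F1 F0 F3 F1, Mat F1 F0 F4 F1,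
    Mat F1 F0 F5 F1, Mat F1 F0 F6 F1, Mat F1 F0 F7 F1]"

definition T2_list :: "mat list" where
  "T2_list = [Mat F1 F0 F0 F1, Mat F0 F1 F1 F0, Mat F2 F3 F3 F2, Mat F3 F2 F2 F3, Mat F4 F5 F5 F4,
    Mat F5 F4 F4 F5, Mat F6 F7 F7 F6, Mat F7 F6 F6 F7]"

definition T3_list :: "mat list" where
  "T3_list = [Mat F1 F0 F0 F1, Mat F0 F2 F5 F0, Mat F2 F6 F4 F2, Mat F3 F4 F1 F3, Mat F4 F1 F7 F4,
    Mat F5 F3 F2 F5, Mat F6 F5 F6 F6, Mat F7 F7 F3 F7]"

definition T4_list :: "mat list" where
  "T4_list = [Mat F1 F0 F0 F1, Mat F0 F3 F6 F0, Mat F2 F5 F1 F2, Mat F3 F6 F7 F3, Mat F4 F4 F3 F4,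
    Mat F5 F7 F5 F5, Mat F6 F2 F4 F6, Mat F7 F1 F2 F7]"

definition T5_list :: "mat list" where
  "T5_list = [Mat F1 F0 F0 F1, Mat F0 F4 F7 F0, Mat F2 F7 F2 F2, Mat F3 F3 F5 F3, Mat F4 F2 F6 F4,
    Mat F5 F6 F1 F5, Mat F6 F1 F3 F6, Mat F7 F5 F4 F7]"

definition T6_list :: "mat list" where
  "T6_list = [Mat F1 F0 F0 F1, Mat F0 F5 F2 F0, Mat F2 F4 F6 F2, Mat F3 F1 F4 F3, Mat F4 F7 F1 F4,
    Mat F5 F2 F3 F5, Mat F6 F6 F5 F6, Mat F7 F3 F7 F7]"

definition T7_list :: "mat list" where
  "T7_list = [Mat F1 F0 F0 F1, Mat F0 F6 F3 F0, Mat F2 F1 F5 F2, Mat F3 F7 F6 F3, Mat F4 F3 F4 F4,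
    Mat F5 F5 F7 F5, Mat F6 F4 F2 F6, Mat F7 F2 F1 F7]"

definition T8_list :: "mat list" where
  "T8_list = [Mat F1 F0 F0 F1, Mat F0 F7 F4 F0, Mat F2 F2 F7 F2, Mat F3 F5 F3 F3, Mat F4 F6 F2 F4,
    Mat F5 F1 F6 F5, Mat F6 F3 F1 F6, Mat F7 F4 F5 F7]"

definition T_lists :: "mat list list" where
  "T_lists = [T0_list, T1_list, T2_list, T3_list, T4_list, T5_list, T6_list, T7_list, T8_list]"

definition W_base :: "mat list list" where
  "W_base = [D1_list, map mfrob D1_list, map mfrob (map mfrob D1_list),
     D4_list, map mfrob D4_list, map mfrob (map mfrob D4_list)]"

definition O_base :: "mat list list" where
  "O_base = [E1_list, mconj g_con E1_list, mconj (mmul g_con g_con) E1_list,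
     E4_list, mconj g_con E4_list, mconj (mmul g_con g_con) E4_list]"

definition P_base :: "mat list list" where
  "P_base = [E1_list, mconj g_con E1_list, mconj (mmul g_con g_con) E1_list,
     mconj f_con E4_list, mconj g_con (mconj f_con E4_list),
     mconj (mmul g_con g_con) (mconj f_con E4_list)]"

text \<open>Conditionals instead of conjunctions let the simplifier stop early when it evaluates
  these tests.\<close>

fun all_list :: "('b \<Rightarrow> bool) \<Rightarrow> 'b list \<Rightarrow> bool" where
  "all_list P [] \<longleftrightarrow> True"
| "all_list P (x # xs) \<longleftrightarrow> (if P x then all_list P xs else False)"

fun ex_list :: "('b \<Rightarrow> bool) \<Rightarrow> 'b list \<Rightarrow> bool" where
  "ex_list P [] \<longleftrightarrow> False"
| "ex_list P (x # xs) \<longleftrightarrow> (if P x then True else ex_list P xs)"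

fun mem_list :: "mat \<Rightarrow> mat list \<Rightarrow> bool" where
  "mem_list m [] \<longleftrightarrow> False"
| "mem_list m (x # xs) \<longleftrightarrow> (if m = x then True else mem_list m xs)"

fun sub_list :: "mat list \<Rightarrow> mat list \<Rightarrow> bool" where
  "sub_list [] ys \<longleftrightarrow> True"
| "sub_list (x # xs) ys \<longleftrightarrow> (if mem_list x ys then sub_list xs ys else False)"

fun meets :: "mat list \<Rightarrow> mat list \<Rightarrow> bool" where
  "meets [] ys \<longleftrightarrow> False"
| "meets (x # xs) ys \<longleftrightarrow> (if mem_list x ys then True else meets xs ys)"

definition all_gf :: "gf8 list" where
  "all_gf = [F0, F1, F2, F3, F4, F5, F6, F7]"

definition sl_d :: "(mat \<Rightarrow> bool) \<Rightarrow> gf8 \<Rightarrow> gf8 \<Rightarrow> gf8 \<Rightarrow> gf8 \<Rightarrow> bool" where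
  "sl_d P a b c d \<longleftrightarrow> (if mdet (Mat a b c d) = F1 then P (Mat a b c d) else True)"

definition sl_c :: "(mat \<Rightarrow> bool) \<Rightarrow> gf8 \<Rightarrow> gf8 \<Rightarrow> gf8 \<Rightarrow> bool" where
  "sl_c P a b c \<longleftrightarrow> all_list (sl_d P a b c) all_gf"

definition sl_b :: "(mat \<Rightarrow> bool) \<Rightarrow> gf8 \<Rightarrow> gf8 \<Rightarrow> bool" where
  "sl_b P a b \<longleftrightarrow> all_list (sl_c P a b) all_gf"

definition sl_a :: "(mat \<Rightarrow> bool) \<Rightarrow> gf8 \<Rightarrow> bool" where
  "sl_a P a \<longleftrightarrow> all_list (sl_b P a) all_gf"

definition all_sl :: "(mat \<Rightarrow> bool) \<Rightarrow> bool" where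
  "all_sl P \<longleftrightarrow> all_list (sl_a P) all_gf"

section \<open>Blocks through the identity and the tests made on them\<close>

definition lines_of :: "mat list \<Rightarrow> mat list list" where
  "lines_of D = map (\<lambda>d. rtrans (minv d) D) D"

text \<open>Each base contributes the blocks \<open>D #> inv d\<close> through 1, the subgroup
  \<open>C_list\<close> only itself. Six bases of 9 elements give 55 long blocks; with the 9 Sylow
  2-subgroups these are the 64 blocks through an affine point of a unital of order 8.\<close>

definition lines :: "mat list list \<Rightarrow> mat list list" where
  "lines Ds = C_list # concat (map lines_of Ds)"

text \<open>This is the trace of the product, computed without its off-diagonal entries.\<close>

fun ltr :: "mat \<Rightarrow> mat \<Rightarrow> gf8" where
  "ltr (Mat a b c d) (Mat p q r s) = gadd (gadd (gmul a p) (gmul b r)) (gadd (gmul c q) (gmul d s))"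

text \<open>The elements of trace 0 in \<open>SL(2,8)\<close> make up the Sylow 2-subgroups. So the
  translate by \<open>y\<close> of the block \<open>l\<close> contains no point joined to 1 by a
  short block.\<close>

fun free :: "mat \<Rightarrow> mat list \<Rightarrow> bool" where
  "free y [] \<longleftrightarrow> True"
| "free y (k # ks) \<longleftrightarrow> (if ltr k y = F0 then False else free y ks)"

text \<open>The translates of \<open>D\<close> that contain \<open>a\<close> are the sets
  \<open>D (inv d) a\<close>. Multiplying \<open>inv d\<close> by \<open>a\<close> first leaves the
  list \<open>D\<close> itself untouched.\<close>

fun count_at :: "mat \<Rightarrow> mat list \<Rightarrow> mat list \<Rightarrow> nat" where
  "count_at a D [] = 0"
| "count_at a D (d # ds) =
     (if free (mmul (minv d) a) D then Suc (count_at a D ds) else count_at a D ds)"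

fun count_bases :: "mat \<Rightarrow> mat list list \<Rightarrow> nat" where
  "count_bases a [] = 0"
| "count_bases a (D # Ds) = count_at a D D + count_bases a Ds"

definition count_free :: "mat list list \<Rightarrow> mat \<Rightarrow> nat" where
  "count_free Ds a = (if free a C_list then Suc (count_bases a Ds) else count_bases a Ds)"

definition avoids :: "nat list \<Rightarrow> mat list list \<Rightarrow> mat \<Rightarrow> bool" where
  "avoids ns Ds a \<longleftrightarrow> count_free Ds a \<notin> set ns"

fun meets_all :: "mat list \<Rightarrow> mat list list \<Rightarrow> bool" where
  "meets_all B [] \<longleftrightarrow> True"
| "meets_all B (l # ls) \<longleftrightarrow> (if meets l B then meets_all B ls else False)"

text \<open>Lists stand for sets here, and the same block may arise with its points in another
  order; hence the two inclusions.\<close>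

definition forced :: "mat list list \<Rightarrow> mat list \<Rightarrow> mat list \<Rightarrow> bool" where
  "forced ls B B' \<longleftrightarrow>
     (if meets_all B' ls then if sub_list B' B then sub_list B B' else False else True)"

fun forced_at :: "mat list list \<Rightarrow> mat list \<Rightarrow> mat \<Rightarrow> mat list \<Rightarrow> mat list \<Rightarrow> bool" where
  "forced_at ls B x D [] \<longleftrightarrow> True"
| "forced_at ls B x D (d # ds) \<longleftrightarrow>
     (if forced ls B (rtrans (mmul (minv d) x) D) then forced_at ls B x D ds else False)"

fun forced_bases :: "mat list list \<Rightarrow> mat list \<Rightarrow> mat \<Rightarrow> mat list list \<Rightarrow> bool" where
  "forced_bases ls B x [] \<longleftrightarrow> True"
| "forced_bases ls B x (D # Ds) \<longleftrightarrow>
     (if forced_at ls B x D D then forced_bases ls B x Ds else False)"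

fun forced_subs :: "mat list list \<Rightarrow> mat list \<Rightarrow> mat \<Rightarrow> mat list list \<Rightarrow> bool" where
  "forced_subs ls B x [] \<longleftrightarrow> True"
| "forced_subs ls B x (D # Ds) \<longleftrightarrow>
     (if forced ls B (rtrans x D) then forced_subs ls B x Ds else False)"

text \<open>The list \<open>xs\<close> supplies the candidates. A block meeting it contains some
  \<open>x\<close> from \<open>xs\<close>, and the blocks through \<open>x\<close> are the sets
  \<open>D (inv d) x\<close> and, for a subgroup \<open>S\<close>, the coset \<open>S x\<close>.
  With six bases of 9 elements this leaves at most 64 candidates for each \<open>x\<close>, instead
  of all blocks.\<close>

fun determined :: "mat list list \<Rightarrow> mat list list \<Rightarrow> mat list list \<Rightarrow> mat list \<Rightarrow> mat list \<Rightarrow> bool" where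
  "determined Ss Ds ls B [] \<longleftrightarrow> True"
| "determined Ss Ds ls B (x # xs) \<longleftrightarrow>
     (if forced_bases ls B x Ds then if forced_subs ls B x Ss then determined Ss Ds ls B xs
      else False else False)"

text \<open>A certificate \<open>(k, y, js)\<close> describes the block \<open>B = D\<^sub>k y\<close> and lists the indices (counted
  from 0) of lines through the identity such that \<open>B\<close> is the only block off the identity that meets
  all of them. Thus \<open>B\<close> has no twin at the identity.\<close>

fun cert_block :: "mat list list \<Rightarrow> nat \<times> mat \<times> nat list \<Rightarrow> mat list" where
  "cert_block Ds (k, y, js) = rtrans y (Ds ! k)"

text \<open>The first line supplies the candidate points, the others the conditions. A block that
  misses 1 meets each line in a point other than 1, so 1 may be removed. It has to be removed, since
  the candidates through a point of the first line include that line itself, which meets all the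
  others in 1.\<close>

definition cert_lines_ok :: "mat list list \<Rightarrow> mat list \<Rightarrow> mat list list \<Rightarrow> bool" where
  "cert_lines_ok Ds B ls \<longleftrightarrow>
     (if mem_list one_mat B then False
      else if meets_all B ls then
        determined (C_list # T_lists) Ds (map (removeAll one_mat) (tl ls)) B
          (removeAll one_mat (hd ls))
      else False)"

fun cert_ok :: "mat list list \<Rightarrow> nat \<times> mat \<times> nat list \<Rightarrow> bool" where
  "cert_ok Ds (k, y, js) \<longleftrightarrow>
     (if k < length Ds then
        if mdet y = F1 then
          if js = [] then False
          else if all_list (\<lambda>j. j < length (lines Ds)) js then
            cert_lines_ok Ds (rtrans y (Ds ! k)) (map ((!) (lines Ds)) js)
          else False
        else False
      else False)"

fun meets_any :: "mat list list \<Rightarrow> mat list \<Rightarrow> bool" where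
  "meets_any Bs L \<longleftrightarrow> ex_list (meets L) Bs"

text \<open>Any point of \<open>L\<close> may be moved to 1. It suffices that one of the resulting
  blocks meets one certified block, because being special is refuted by a single point.\<close>

definition covered :: "mat list list \<Rightarrow> mat list \<Rightarrow> bool" where
  "covered Bs L \<longleftrightarrow> ex_list (meets_any Bs) (lines_of L)"

fun quot_free_at :: "mat \<Rightarrow> mat list \<Rightarrow> bool" where
  "quot_free_at d [] \<longleftrightarrow> True"
| "quot_free_at d (k # ks) \<longleftrightarrow>
     (if d = k then quot_free_at d ks
      else if ltr (minv d) k = F0 then False else quot_free_at d ks)"

text \<open>For \<open>d\<close> and \<open>k\<close> of determinant 1, trace 0 of the product of
  \<open>minv d\<close> and \<open>k\<close> means that they are joined by a short block.\<close>

fun quot_free :: "mat list \<Rightarrow> mat list \<Rightarrow> bool" where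
  "quot_free [] D \<longleftrightarrow> True"
| "quot_free (d # ds) D \<longleftrightarrow>
     (if mdet d = F1 then if quot_free_at d D then quot_free ds D else False else False)"

fun not_sub_any :: "mat list \<Rightarrow> mat list list \<Rightarrow> bool" where
  "not_sub_any l [] \<longleftrightarrow> True"
| "not_sub_any l (k # ks) \<longleftrightarrow> (if sub_list l k then False else not_sub_any l ks)"

text \<open>If two entries had the same underlying set, the earlier would be contained in the later.
  Testing this one inclusion therefore allows list entries to be counted in place of blocks.\<close>

fun separated :: "mat list list \<Rightarrow> bool" where
  "separated [] \<longleftrightarrow> True"
| "separated (l # ls) \<longleftrightarrow> (if not_sub_any l ls then separated ls else False)"

text \<open>The first base is pinned down by four right cosets of \<open>T3_list\<close>: the group
  itself, which it meets in 1, and the cosets through its entries 1, 2 and 8. The cosets of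
  \<open>T3_list\<close> form the class in question and are left out of the candidates. The same
  choice of indices works for all three structures.\<close>

definition flat_cert :: "mat list list \<Rightarrow> bool" where
  "flat_cert Ds \<longleftrightarrow>
     (if mem_list one_mat (hd Ds) then
        determined (C_list # remove1 T3_list T_lists) Ds
          (map (\<lambda>j. rtrans (hd Ds ! j) T3_list) [1, 2, 8]) (hd Ds) T3_list
      else False)"

fun closed_list :: "mat list \<Rightarrow> mat list \<Rightarrow> bool" where
  "closed_list H [] \<longleftrightarrow> True"
| "closed_list H (x # xs) \<longleftrightarrow>
     (if mdet x = F1 then
        if mem_list (minv x) H then if sub_list (rtrans x H) H then closed_list H xs else False
        else False
      else False)"

definition subgroup_list :: "mat list \<Rightarrow> bool" where
  "subgroup_list H \<longleftrightarrow> (if mem_list one_mat H then closed_list H H else False)"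

text \<open>An element of a group of order 8 has trivial eighth power. In characteristic 2 its
  eigenvalues are then 1, and the trace is \<open>1 + 1 = 0\<close>.\<close>

definition unipotent_test :: "mat \<Rightarrow> bool" where
  "unipotent_test m \<longleftrightarrow>
     (if mmul (mmul (mmul m m) (mmul m m)) (mmul (mmul m m) (mmul m m)) = one_mat
      then mtr m = F0 else True)"

definition trace_test :: "mat \<Rightarrow> bool" where
  "trace_test m \<longleftrightarrow> (if mtr m = F0 then ex_list (mem_list m) T_lists else True)"

fun commute_at :: "mat list \<Rightarrow> mat \<Rightarrow> mat list \<Rightarrow> bool" where
  "commute_at l x [] \<longleftrightarrow> True"
| "commute_at l x (y # ys) \<longleftrightarrow>
     (if ltr x y = F0 then if mem_list y l then commute_at l x ys else False
      else commute_at l x ys)"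

text \<open>If \<open>x\<close>, \<open>y\<close> and \<open>x y\<close> have trace 0, all three
  square to 1, so \<open>x\<close> and \<open>y\<close> commute. The centralizer of an involution in
  \<open>SL(2,8)\<close> is its Sylow 2-subgroup, which must therefore contain \<open>y\<close>. The
  identity commutes with everything and is exempt.\<close>

definition commute_elem :: "mat list \<Rightarrow> mat \<Rightarrow> bool" where
  "commute_elem l x \<longleftrightarrow>
     (if mtr x = F0 then if x = one_mat then True else all_list (commute_at l x) T_lists else False)"

definition commute_list :: "mat list \<Rightarrow> bool" where
  "commute_list l \<longleftrightarrow> all_list (commute_elem l) l"

definition unit_det :: "gf8 \<Rightarrow> gf8 \<Rightarrow> gf8 \<Rightarrow> gf8 \<Rightarrow> bool" where
  "unit_det a b c d \<longleftrightarrow> mdet (Mat a b c d) = F1"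

definition row_count :: "gf8 \<Rightarrow> gf8 \<Rightarrow> gf8 \<Rightarrow> nat" where
  "row_count a b c = length (filter (unit_det a b c) all_gf)"

definition pair_count :: "gf8 \<Rightarrow> gf8 \<Rightarrow> nat" where
  "pair_count a b = sum_list (map (row_count a b) all_gf)"

text \<open>Each of the 63 nonzero first rows can be completed to determinant 1 in 8 ways, which
  gives the group order 504.\<close>

definition pair_count_test :: "gf8 \<Rightarrow> gf8 \<Rightarrow> bool" where
  "pair_count_test a b \<longleftrightarrow> pair_count a b = (if a = F0 then if b = F0 then 0 else 8 else 8)"

definition order_test :: "gf8 \<Rightarrow> bool" where
  "order_test a \<longleftrightarrow> all_list (pair_count_test a) all_gf"

text \<open>The length makes the positions 1, 2 and 8 of \<open>flat_cert\<close> legitimate; two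
  different entries are what \<open>base_two\<close> asks for.\<close>

definition base_ok :: "mat list \<Rightarrow> bool" where
  "base_ok D \<longleftrightarrow>
     (if length D = 9 then if D ! 0 = D ! 1 then False else quot_free D D else False)"

text \<open>Found by computer search.\<close>

definition W_certs :: "(nat \<times> mat \<times> nat list) list" where
  "W_certs = [(0, Mat F1 F0 F5 F1, [0, 13, 27, 42]),
    (3, Mat F2 F2 F4 F1, [0, 7, 27, 39]),
    (1, Mat F6 F6 F6 F5, [9, 21, 23, 29])]"

definition O_certs :: "(nat \<times> mat \<times> nat list) list" where
  "O_certs = [(0, Mat F1 F6 F1 F7, [0, 3, 33, 52]),
    (0, Mat F1 F5 F3 F5, [0, 2, 31, 53]),
    (0, Mat F2 F3 F3 F2, [15, 25, 29, 32])]"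

definition P_certs :: "(nat \<times> mat \<times> nat list) list" where
  "P_certs = [(0, Mat F1 F6 F1 F7, [0, 3, 33, 45]),
    (0, Mat F1 F5 F3 F5, [0, 2, 32, 44]),
    (5, Mat F1 F3 F2 F7, [13, 26, 35, 44])]"

section \<open>Evaluation of the finite tests\<close>

lemma subgroup_lists: "all_list subgroup_list (C_list # T_lists)"
  by code_simp

lemma T_lists_distinct: "all_list distinct T_lists" "list_all (\<lambda>l. length l = 8) T_lists"
  by code_simp+

lemma unipotent_trace: "all_sl unipotent_test"
  by code_simp

lemma trace_zero_T: "all_sl trace_test"
  by code_simp

lemma commuting_T: "all_list commute_list T_lists"
  by code_simp

lemma order_tests: "all_list order_test all_gf"
  by code_simp

lemma W_checks:
  "list_all base_ok (C_list # W_base)"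
  "list_all (covered (map (cert_block W_base) W_certs)) (C_list # W_base @ T_lists)"
  "flat_cert W_base"
  "separated (lines W_base)"
  by code_simp+

lemma W_certs_ok: "list_all (cert_ok W_base) W_certs"
  by code_simp

lemma O_checks:
  "list_all base_ok (C_list # O_base)"
  "list_all (covered (map (cert_block O_base) O_certs)) (C_list # O_base @ T_lists)"
  "flat_cert O_base"
  "separated (lines O_base)"
  by code_simp+

lemma O_certs_ok: "list_all (cert_ok O_base) O_certs"
  by code_simp

lemma P_checks:
  "list_all base_ok (C_list # P_base)"
  "list_all (covered (map (cert_block P_base) P_certs)) (C_list # P_base @ T_lists)"
  "flat_cert P_base"
  "separated (lines P_base)"
  by code_simp+

lemma P_certs_ok: "list_all (cert_ok P_base) P_certs"
  by code_simp

lemma W_avoids: "all_sl (avoids [13] W_base)"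
  by code_simp

lemma O_avoids: "all_sl (avoids [13, 24] O_base)"
  by code_simp

text \<open>The witness is the fourth power of \<open>g_con\<close>, an element of
  \<open>C_list\<close>.\<close>

lemma W_count: "count_free W_base (Mat F2 F4 F4 F6) = 24"
  by code_simp

lemma P_count: "count_free P_base (Mat F0 F2 F5 F2) = 13"
  by code_simp

section \<open>The special linear group over the field with eight elements\<close>

primrec gval :: "'a::field \<Rightarrow> gf8 \<Rightarrow> 'a" where
  "gval z F0 = 0"
| "gval z F1 = 1"
| "gval z F2 = z"
| "gval z F3 = z + 1"
| "gval z F4 = z\<^sup>2"
| "gval z F5 = z\<^sup>2 + 1"
| "gval z F6 = z\<^sup>2 + z"
| "gval z F7 = z\<^sup>2 + (z + 1)"

fun mval :: "'a::field \<Rightarrow> mat \<Rightarrow> 'a^2^2" where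
  "mval z (Mat a b c d) = mat2 (gval z a) (gval z b) (gval z c) (gval z d)"

definition sval :: "'a::field \<Rightarrow> mat list \<Rightarrow> ('a^2^2) set" where
  "sval z l = mval z ` set l"

lemma UNIV_gf8: "UNIV = set all_gf"
proof -
  have "a \<in> set all_gf" for a by (cases a) (simp_all add: all_gf_def)
  then show ?thesis by blast
qed

instance gf8 :: finite
  by intro_classes (simp add: UNIV_gf8)

lemma card_UNIV_gf8: "CARD(gf8) = 8"
  by (simp add: UNIV_gf8 all_gf_def)

lemma gadd_self_iff: "gadd a b = F0 \<longleftrightarrow> a = b"
  by (cases a; cases b) simp_all

lemma gmul_inverse: "a \<noteq> F0 \<Longrightarrow> \<exists>b. gmul a b = F1"
proof -
  have "a \<noteq> F0 \<Longrightarrow> ex_list (\<lambda>b. gmul a b = F1) all_gf"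
    by (cases a) (simp_all add: all_gf_def)
  moreover have "ex_list P l \<Longrightarrow> \<exists>x. P x" for P :: "gf8 \<Rightarrow> bool" and l
    by (induction l) (auto split: if_splits)
  ultimately show "a \<noteq> F0 \<Longrightarrow> \<exists>b. gmul a b = F1" by blast
qed

lemma mat2_nth:
  "mat2 a b c d $ 1 $ 1 = a" "mat2 a b c d $ 1 $ 2 = b"
  "mat2 a b c d $ 2 $ 1 = c" "mat2 a b c d $ 2 $ 2 = d"
  by (simp_all add: mat2_def)

lemma mat2_eq_iff: "mat2 a b c d = mat2 a' b' c' d' \<longleftrightarrow> a = a' \<and> b = b' \<and> c = c' \<and> d = d'"
  by (metis mat2_nth)

lemma mat2_cases: "A = mat2 (A $ 1 $ 1) (A $ 1 $ 2) (A $ 2 $ 1) (A $ 2 $ 2)"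
  by (simp add: vec_eq_iff forall_2 mat2_nth)

lemma mat2_mult:
  "mat2 a b c d ** mat2 p q r s = mat2 (a * p + b * r) (a * q + b * s) (c * p + d * r) (c * q + d * s)"
  by (simp add: vec_eq_iff forall_2 mat2_nth matrix_matrix_mult_def sum_2)

lemma det_mat2: "det (mat2 a b c d) = a * d - b * c"
  by (simp add: det_2 mat2_nth)

lemma mat2_one: "mat2 1 0 0 1 = mat 1"
  by (simp add: vec_eq_iff forall_2 mat2_nth mat_def)

lemma SL2_simps [simp]:
  "carrier SL2 = {A. det A = 1}" "A \<otimes>\<^bsub>SL2\<^esub> B = A ** B" "\<one>\<^bsub>SL2\<^esub> = mat 1"
  by (simp_all add: SL2_def)

lemma all_list_iff: "all_list P l \<longleftrightarrow> (\<forall>x\<in>set l. P x)"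
  by (induction l) auto

lemma ex_list_iff: "ex_list P l \<longleftrightarrow> (\<exists>x\<in>set l. P x)"
  by (induction l) auto

lemma mem_list_iff: "mem_list m l \<longleftrightarrow> m \<in> set l"
  by (induction l) auto

lemma sub_list_iff: "sub_list l k \<longleftrightarrow> set l \<subseteq> set k"
  by (induction l) (auto simp: mem_list_iff)

lemma meets_iff: "meets l k \<longleftrightarrow> set l \<inter> set k \<noteq> {}"
  by (induction l) (auto simp: mem_list_iff)

lemma meets_all_iff: "meets_all B ls \<longleftrightarrow> (\<forall>l\<in>set ls. set l \<inter> set B \<noteq> {})"
  by (induction ls) (auto simp: meets_iff)

lemma set_rtrans: "set (rtrans y l) = (\<lambda>d. mmul d y) ` set l"
  by (induction l) auto

lemma free_iff: "free y l \<longleftrightarrow> (\<forall>k\<in>set l. ltr k y \<noteq> F0)"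
  by (induction l) auto

lemma all_sl_iff: "all_sl P \<longleftrightarrow> (\<forall>m. mdet m = F1 \<longrightarrow> P m)"
proof -
  have "all_list Q all_gf \<longleftrightarrow> (\<forall>a. Q a)" for Q
    using UNIV_gf8 by (auto simp: all_list_iff)
  then have "all_sl P \<longleftrightarrow> (\<forall>a b c d. mdet (Mat a b c d) = F1 \<longrightarrow> P (Mat a b c d))"
    by (simp add: all_sl_def sl_a_def[abs_def] sl_b_def[abs_def] sl_c_def[abs_def] sl_d_def)
  then show ?thesis by (metis mat.exhaust)
qed

locale gf8_field =
  fixes z :: "'a::field"
  assumes card8: "CARD('a) = 8" and z_cube: "z ^ 3 = z + 1"
begin

lemma finite_UNIV_field: "finite (UNIV :: 'a set)"
  using card8 by (metis card.infinite zero_neq_numeral)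

text \<open>Adding 1 permutes the field. Comparing the sums of all elements before and after gives
  \<open>8 = 0\<close>, so the cube of \<open>1 + 1\<close> vanishes.\<close>

lemma two_zero: "(1::'a) + 1 = 0"
proof -
  have "(\<Sum>x\<in>UNIV. x) = (\<Sum>x\<in>UNIV. x + (1::'a))"
    by (rule sum.reindex_bij_betw[symmetric]) (rule bij_betwI[where g = "\<lambda>x. x - 1"]; simp)
  also have "\<dots> = (\<Sum>x\<in>UNIV. x) + of_nat CARD('a)"
    by (simp add: sum.distrib)
  finally have "(of_nat 8 :: 'a) = 0" by (simp only: card8) simp
  then have "(1 + 1 :: 'a) ^ 3 = 0" by (simp add: power3_eq_cube)
  then show ?thesis using power_eq_0_iff by blast
qed

lemma add_self: "x + x = (0::'a)"
  using two_zero by (metis distrib_left mult_1_right mult_zero_right)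

lemma add_self_left: "x + (x + y) = (y::'a)"
  by (simp add: add_self add.assoc[symmetric])

lemma minus_eq: "- x = (x::'a)"
  using add_self by (metis add_eq_0_iff)

lemma diff_eq: "x - y = x + (y::'a)"
  by (metis minus_eq diff_conv_add_uminus)

lemma z_powers: "z * z\<^sup>2 = z + 1" "z\<^sup>2 * z = z + 1" "z\<^sup>2 * z\<^sup>2 = z\<^sup>2 + z" "z * z = z\<^sup>2"
  "z ^ 4 = z\<^sup>2 + z" "z ^ 5 = z\<^sup>2 + (z + 1)" "z ^ 6 = z\<^sup>2 + 1"
proof -
  show 1: "z * z\<^sup>2 = z + 1" "z\<^sup>2 * z = z + 1" "z * z = z\<^sup>2"
    using z_cube by (simp_all add: power2_eq_square power3_eq_cube mult.assoc)
  have 4: "z * (z * z\<^sup>2) = z\<^sup>2 + z" unfolding 1 by (simp add: distrib_left 1)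
  then show "z\<^sup>2 * z\<^sup>2 = z\<^sup>2 + z" by (simp add: power2_eq_square mult.assoc)
  show four: "z ^ 4 = z\<^sup>2 + z" using 4 by (simp add: eval_nat_numeral mult.assoc)
  have "z ^ 5 = z * (z\<^sup>2 + z)" using four by (simp add: eval_nat_numeral)
  then show five: "z ^ 5 = z\<^sup>2 + (z + 1)" by (simp add: distrib_left 1 add_ac)
  have "z ^ 6 = z * (z\<^sup>2 + (z + 1))" using five by (simp add: eval_nat_numeral)
  then show "z ^ 6 = z\<^sup>2 + 1" by (simp add: distrib_left 1 add_ac add_self add_self_left)
qed

lemma gval_gadd: "gval z (gadd a b) = gval z a + gval z b"
  by (cases a; cases b) (simp_all add: add_ac add_self add_self_left)

lemma gval_gmul: "gval z (gmul a b) = gval z a * gval z b"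
  by (cases a; cases b)
    (simp_all add: distrib_left distrib_right z_powers add_ac add_self add_self_left)

text \<open>A nonzero table element has an inverse in the table, and \<open>gval\<close> respects
  products, so only \<open>F0\<close> is mapped to 0. Differences are sums, and
  \<open>gadd_self_iff\<close> concludes.\<close>

lemma gval_eq_iff: "gval z a = gval z b \<longleftrightarrow> a = b"
proof -
  have zero: "c = F0" if "gval z c = 0" for c
  proof (rule ccontr)
    assume "c \<noteq> F0"
    then obtain d where "gmul c d = F1" using gmul_inverse by blast
    then have "gval z c * gval z d = 1" by (metis gval_gmul gval.simps(2))
    then show False using that by simp
  qed
  have "a = b" if "gval z a = gval z b"
  proof -
    have "gval z (gadd a b) = 0" using that by (simp add: gval_gadd add_self)
    then show ?thesis using zero gadd_self_iff by blast
  qed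
  then show ?thesis by blast
qed

lemma gval_surj: "\<exists>a. gval z a = x"
proof -
  have "card (range (gval z)) = CARD('a)"
    using card_UNIV_gf8 card8 by (simp add: card_image inj_on_def gval_eq_iff)
  then have "range (gval z) = UNIV"
    using finite_UNIV_field by (simp add: card_eq_UNIV_imp_eq_UNIV)
  then show ?thesis by (metis surjD)
qed

lemma mval_eq_iff: "mval z m = mval z n \<longleftrightarrow> m = n"
  by (cases m; cases n) (simp add: mat2_eq_iff gval_eq_iff)

lemma mval_surj: "\<exists>m. mval z m = A"
proof -
  obtain a b c d where "gval z a = A $ 1 $ 1" "gval z b = A $ 1 $ 2"
    "gval z c = A $ 2 $ 1" "gval z d = A $ 2 $ 2"
    using gval_surj by metis
  then have "mval z (Mat a b c d) = A" using mat2_cases[of A] by simp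
  then show ?thesis ..
qed

lemma mval_mmul: "mval z (mmul m n) = mval z m ** mval z n"
  by (cases m; cases n) (simp add: mat2_mult gval_gadd gval_gmul)

lemma det_mval: "det (mval z m) = gval z (mdet m)"
  by (cases m) (simp add: det_mat2 gval_gadd gval_gmul diff_eq)

lemma mval_carrier: "mval z m \<in> carrier SL2 \<longleftrightarrow> mdet m = F1"
  using gval_eq_iff[of "mdet m" F1] by (simp add: det_mval)

lemma carrier_mval: "carrier SL2 = mval z ` {m. mdet m = F1}"
proof (intro equalityI subsetI)
  fix A :: "'a^2^2" assume A: "A \<in> carrier SL2"
  obtain m where m: "mval z m = A" using mval_surj by blast
  with A mval_carrier have "mdet m = F1" by metis
  with m show "A \<in> mval z ` {m. mdet m = F1}" by blast
next
  fix A :: "'a^2^2" assume "A \<in> mval z ` {m. mdet m = F1}"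
  then obtain m where "mdet m = F1" "A = mval z m" by blast
  then show "A \<in> carrier SL2" using mval_carrier by simp
qed

lemma mval_one: "mval z one_mat = mat 1"
  by (simp add: mat2_one)

text \<open>The law is pulled back from matrices over the field along the injective
  \<open>mval\<close>; a case distinction over twelve table elements would be far too large.\<close>

lemma mmul_assoc: "mmul (mmul k m) n = mmul k (mmul m n)"
  by (simp add: mval_eq_iff[symmetric] mval_mmul matrix_mul_assoc)

lemma mmul_minv: "mdet m = F1 \<Longrightarrow> mmul (minv m) m = one_mat"
proof -
  assume "mdet m = F1"
  then have "det (mval z m) = 1" by (simp add: det_mval)
  then have "mval z (minv m) ** mval z m = mat 1"
    by (cases m) (simp add: det_mat2 mat2_mult diff_eq mat2_one[symmetric] mat2_eq_iff
        mult.commute add_self add.commute)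
  then show ?thesis by (simp add: mval_eq_iff[symmetric] mval_mmul mval_one del: mval.simps)
qed

lemma mdet_minv: "mdet (minv m) = mdet m"
proof -
  have "det (mval z (minv m)) = det (mval z m)" by (cases m) (simp add: det_mat2 mult.commute)
  then show ?thesis by (simp add: det_mval gval_eq_iff)
qed

lemma mdet_mmul: "mdet (mmul m n) = gmul (mdet m) (mdet n)"
  by (simp add: gval_eq_iff[symmetric] det_mval[symmetric] mval_mmul det_mul gval_gmul)

lemma group_SL2: "group (SL2 :: ('a^2^2) monoid)"
proof (rule groupI)
  fix x :: "'a^2^2" assume "x \<in> carrier SL2"
  then obtain m where m: "mdet m = F1" "x = mval z m" using carrier_mval by blast
  then have "mval z (minv m) \<otimes>\<^bsub>SL2\<^esub> x = \<one>\<^bsub>SL2\<^esub>"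
    using mmul_minv by (metis SL2_simps(2,3) mval_mmul mval_one)
  moreover have "mval z (minv m) \<in> carrier SL2" using m mdet_minv mval_carrier by metis
  ultimately show "\<exists>y\<in>carrier SL2. y \<otimes>\<^bsub>SL2\<^esub> x = \<one>\<^bsub>SL2\<^esub>" by blast
qed (auto simp: det_mul matrix_mul_assoc)

sublocale SL2: group "SL2 :: ('a^2^2) monoid"
  by (rule group_SL2)

lemma inv_mval: "mdet m = F1 \<Longrightarrow> inv\<^bsub>SL2\<^esub> (mval z m) = mval z (minv m)"
proof -
  assume m: "mdet m = F1"
  have "mval z (minv m) \<otimes>\<^bsub>SL2\<^esub> mval z m = \<one>\<^bsub>SL2\<^esub>"
    using mmul_minv[OF m] by (metis SL2_simps(2,3) mval_mmul mval_one)
  then show ?thesis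
    using m mdet_minv mval_carrier SL2.inv_equality by metis
qed

lemma mmul_minv': "mdet m = F1 \<Longrightarrow> mmul m (minv m) = one_mat"
  using SL2.r_inv[of "mval z m"] inv_mval[of m] mval_carrier[of m]
  by (simp add: mval_eq_iff[symmetric] mval_mmul mval_one del: mval.simps)

lemma mmul_one [simp]: "mmul m one_mat = m" "mmul one_mat m = m"
  by (simp_all add: mval_eq_iff[symmetric] mval_mmul mval_one del: mval.simps)

lemma ltr_eq: "ltr m n = mtr (mmul m n)"
  by (cases m; cases n) (simp add: gval_eq_iff[symmetric] gval_gadd add_ac)

lemma mval_sval: "mval z m \<in> sval z l \<longleftrightarrow> m \<in> set l"
  by (auto simp: sval_def mval_eq_iff)

lemma sval_eq_iff: "sval z l = sval z k \<longleftrightarrow> set l = set k"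
  by (simp add: sval_def inj_image_eq_iff inj_def mval_eq_iff)

lemma sval_Int: "sval z l \<inter> sval z k \<noteq> {} \<longleftrightarrow> set l \<inter> set k \<noteq> {}"
  by (auto simp: sval_def mval_eq_iff)

lemma sval_r_coset: "sval z l #>\<^bsub>SL2\<^esub> mval z y = sval z (rtrans y l)"
  by (simp add: r_coset_def sval_def set_rtrans image_image mval_mmul UNION_singleton_eq_range)

lemma sval_conj:
  assumes "mdet x = F1"
  shows "conj_set SL2 (sval z l) (mval z x) = sval z (mconj x l)"
  using assms
  by (simp add: conj_set_def inv_mval l_coset_def r_coset_def sval_def mconj_def mval_mmul
      image_image UNION_singleton_eq_range)

lemma mval_mfrob: "mval z (mfrob m) = map_matrix (\<lambda>x. x ^ 2) (mval z m)"
  by (cases m) (simp add: vec_eq_iff forall_2 mat2_nth map_matrix_def gval_gmul power2_eq_square)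

lemma sval_frob: "frobenius (sval z l) = sval z (map mfrob l)"
  by (simp add: frobenius_def sval_def image_image mval_mfrob)

lemma base_vals: "D1 z = sval z D1_list" "D4 z = sval z D4_list" "E1 z = sval z E1_list"
  "E4 z = sval z E4_list" "g_mat z = mval z g_con" "f_mat = mval z f_con"
  by (simp_all add: D1_def D4_def E1_def E4_def sval_def D1_list_def D4_list_def E1_list_def
      E4_list_def mat2_one z_powers z_cube g_mat_def f_mat_def)

lemma subgroup_sval:
  assumes "subgroup_list l"
  shows "subgroup (sval z l) SL2"
proof -
  have "closed_list H xs \<longleftrightarrow> (\<forall>x\<in>set xs. mdet x = F1 \<and> minv x \<in> set H \<and> set (rtrans x H) \<subseteq> set H)" for H xs
    by (induction xs) (auto simp: mem_list_iff sub_list_iff)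
  then have l: "one_mat \<in> set l" and c: "\<And>x. x \<in> set l \<Longrightarrow> mdet x = F1 \<and> minv x \<in> set l"
    and m: "\<And>x y. x \<in> set l \<Longrightarrow> y \<in> set l \<Longrightarrow> mmul y x \<in> set l"
    using assms by (auto simp: subgroup_list_def mem_list_iff set_rtrans image_subset_iff split: if_splits)
  show ?thesis
  proof (rule SL2.subgroupI)
    show "sval z l \<subseteq> carrier SL2" using c mval_carrier by (auto simp: sval_def simp del: SL2_simps)
    show "sval z l \<noteq> {}" using l by (auto simp: sval_def)
    show "inv\<^bsub>SL2\<^esub> a \<in> sval z l" if "a \<in> sval z l" for a
      using that c inv_mval by (auto simp: sval_def)
    show "a \<otimes>\<^bsub>SL2\<^esub> b \<in> sval z l" if "a \<in> sval z l" "b \<in> sval z l" for a b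
      using that m by (auto simp: sval_def mval_mmul[symmetric])
  qed
qed

lemma C_sub_val: "C_sub z = sval z C_list"
proof -
  have sub: "subgroup (sval z C_list) SL2" using subgroup_lists subgroup_sval by (simp add: all_list_iff del: all_list.simps)
  let ?K = "generate SL2 {mval z g_con}"
  have g: "mval z g_con \<in> carrier SL2" by (subst mval_carrier) simp
  have K: "subgroup ?K SL2" using g by (intro SL2.generate_is_subgroup) (simp del: SL2_simps)
  have step: "mval z (mmul m g_con) \<in> ?K" if "mval z m \<in> ?K" for m
    using subgroup.m_closed[OF K that generate.incl[of "mval z g_con"]]
    by (simp add: mval_mmul)
  have one: "mval z one_mat \<in> ?K" using generate.one[of SL2] by (simp add: mval_one del: mval.simps)
  \<comment> \<open>Up to eight multiplications by \<open>g_con\<close>, starting from the identity,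
    produce the nine listed powers.\<close>
  have "sval z C_list \<subseteq> ?K"
    unfolding sval_def C_list_def
    using one step[OF one] step[OF step[OF one]] step[OF step[OF step[OF one]]]
      step[OF step[OF step[OF step[OF one]]]]
      step[OF step[OF step[OF step[OF step[OF one]]]]]
      step[OF step[OF step[OF step[OF step[OF step[OF one]]]]]]
      step[OF step[OF step[OF step[OF step[OF step[OF step[OF one]]]]]]]
      step[OF step[OF step[OF step[OF step[OF step[OF step[OF step[OF one]]]]]]]]
    by (simp del: mval.simps)
  moreover have "?K \<subseteq> sval z C_list"
    using sub by (intro SL2.generate_subgroup_incl) (simp_all add: mval_sval C_list_def del: mval.simps)
  ultimately show ?thesis by (simp add: C_sub_def base_vals)
qed

section \<open>The order of SL(2,8) and its Sylow 2-subgroups\<close>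

lemma T_mdet: "l \<in> set T_lists \<Longrightarrow> x \<in> set l \<Longrightarrow> mdet x = F1"
proof -
  assume "l \<in> set T_lists" "x \<in> set l"
  then have "subgroup (sval z l) SL2"
    using subgroup_lists subgroup_sval by (simp add: all_list_iff del: all_list.simps)
  then have "mval z x \<in> carrier SL2"
    using \<open>x \<in> set l\<close> mval_sval subgroup.subset by blast
  then show ?thesis by (simp only: mval_carrier)
qed

lemma card_sval_T: "l \<in> set T_lists \<Longrightarrow> card (sval z l) = 8"
proof -
  assume l: "l \<in> set T_lists"
  then have "distinct l" "length l = 8"
    using T_lists_distinct by (auto simp: all_list_iff list_all_iff simp del: all_list.simps)
  moreover have "card (sval z l) = card (set l)"
    unfolding sval_def by (rule card_image) (simp add: inj_on_def mval_eq_iff)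
  ultimately show ?thesis by (simp add: distinct_card)
qed

lemma pair_count_eq: "card {(c, d). mdet (Mat a b c d) = F1} = (if a = F0 \<and> b = F0 then 0 else 8)"
proof -
  have "{(c, d). mdet (Mat a b c d) = F1} = (SIGMA c:UNIV. {d. unit_det a b c d})"
    by (auto simp: unit_det_def)
  moreover have "card {d. unit_det a b c d} = row_count a b c" for c
  proof -
    have "{d. unit_det a b c d} = set (filter (unit_det a b c) all_gf)"
      using UNIV_gf8 by auto
    moreover have "distinct (filter (unit_det a b c) all_gf)"
      by (rule distinct_filter) (simp add: all_gf_def)
    ultimately show ?thesis unfolding row_count_def using distinct_card by metis
  qed
  moreover have "(\<Sum>c\<in>UNIV. row_count a b c) = pair_count a b"
    unfolding pair_count_def UNIV_gf8
    by (rule sum_list_distinct_conv_sum_set[symmetric]) (simp add: all_gf_def)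
  moreover have "pair_count_test a b"
    using order_tests UNIV_gf8 by (auto simp: all_list_iff order_test_def simp del: all_list.simps)
  ultimately show ?thesis by (simp add: card_SigmaI pair_count_test_def)
qed

lemma order_SL2: "order (SL2 :: ('a^2^2) monoid) = 504"
proof -
  let ?S = "SIGMA p:UNIV. {(c, d). mdet (Mat (fst p) (snd p) c d) = F1}"
  have "{m. mdet m = F1} = (\<lambda>((a, b), (c, d)). Mat a b c d) ` ?S"
  proof (intro equalityI subsetI)
    fix m assume "m \<in> {m. mdet m = F1}"
    then show "m \<in> (\<lambda>((a, b), (c, d)). Mat a b c d) ` ?S"
      by (cases m) (force simp: image_iff)
  qed auto
  moreover have "inj_on (\<lambda>((a, b), (c, d)). Mat a b c d) ?S"
    by (auto simp: inj_on_def)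
  ultimately have "card {m. mdet m = F1} = card ?S" by (simp add: card_image)
  also have "\<dots> = (\<Sum>p\<in>UNIV. card {(c, d). mdet (Mat (fst p) (snd p) c d) = F1})"
    by (intro card_SigmaI) auto
  also have "\<dots> = (\<Sum>p\<in>UNIV. if p = (F0, F0) then 0 else 8)"
  proof (rule sum.cong)
    fix p :: "gf8 \<times> gf8"
    show "card {(c, d). mdet (Mat (fst p) (snd p) c d) = F1} = (if p = (F0, F0) then 0 else 8)"
      by (cases p) (simp only: pair_count_eq fst_conv snd_conv prod.inject)
  qed simp
  also have "\<dots> = (\<Sum>p\<in>UNIV - {(F0, F0)}. 8)"
    by (intro sum.mono_neutral_cong_right) auto
  also have "\<dots> = 504"
    by (simp add: card_Diff_singleton card_UNIV_gf8 card_cartesian_product UNIV_Times_UNIV[symmetric]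
        del: UNIV_Times_UNIV)
  finally have "card {m. mdet m = F1} = 504" .
  moreover have "card (carrier (SL2 :: ('a^2^2) monoid)) = card {m. mdet m = F1}"
    unfolding carrier_mval by (rule card_image) (simp add: inj_on_def mval_eq_iff)
  ultimately show ?thesis by (simp add: order_def)
qed

lemma sylow_iff_card: "T \<in> sylow_subgroups 2 SL2 \<longleftrightarrow> subgroup T SL2 \<and> card T = 8"
  for T :: "('a^2^2) set"
proof -
  have "multiplicity 2 (504 :: nat) = 3" by (rule multiplicity_eqI) auto
  then show ?thesis by (simp add: sylow_subgroups_def order_SL2)
qed

lemma trace_zero_list: "mdet m = F1 \<Longrightarrow> mtr m = F0 \<Longrightarrow> \<exists>l\<in>set T_lists. m \<in> set l"
  using trace_zero_T unfolding all_sl_iff trace_test_def ex_list_iff mem_list_iff by metis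

lemma sylow_trace:
  assumes "subgroup T SL2" "card T = 8" "mval z m \<in> T"
  shows "mtr m = F0" "mdet m = F1"
proof -
  interpret T: group "SL2\<lparr>carrier := T\<rparr>" using SL2.subgroup_imp_group assms(1) .
  show m: "mdet m = F1" using assms subgroup.subset mval_carrier by blast
  have "mval z m [^]\<^bsub>SL2\<lparr>carrier := T\<rparr>\<^esub> order (SL2\<lparr>carrier := T\<rparr>) = \<one>\<^bsub>SL2\<^esub>"
    using T.pow_order_eq_1[of "mval z m"] assms by simp
  then have "mval z m [^]\<^bsub>SL2\<lparr>carrier := T\<rparr>\<^esub> (8::nat) = mat 1"
    using assms(2) by (simp add: order_def)
  then have "mval z (mmul (mmul (mmul m m) (mmul m m)) (mmul (mmul m m) (mmul m m))) = mval z one_mat"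
    by (simp add: mval_mmul eval_nat_numeral matrix_mul_assoc mval_one del: mval.simps)
  then have "mmul (mmul (mmul m m) (mmul m m)) (mmul (mmul m m) (mmul m m)) = one_mat"
    by (simp only: mval_eq_iff)
  then show "mtr m = F0"
    using unipotent_trace m unfolding all_sl_iff unipotent_test_def by metis
qed

text \<open>A subgroup \<open>T\<close> of order 8 consists of elements of trace 0. Fix
  \<open>x\<close> in \<open>T\<close> other than the identity and a listed group containing
  \<open>x\<close>. For each \<open>y\<close> in \<open>T\<close> the product \<open>x y\<close>
  lies in \<open>T\<close> and has trace 0 again, so \<open>commuting_T\<close> puts
  \<open>y\<close> into the same listed group. Equality follows by size.\<close>

lemma sylow_lists: "sylow_subgroups 2 SL2 = sval z ` set T_lists"
proof (intro equalityI subsetI)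
  fix T :: "('a^2^2) set" assume "T \<in> sylow_subgroups 2 SL2"
  then have T: "subgroup T SL2" "card T = 8" by (simp_all add: sylow_iff_card)
  have "\<not> T \<subseteq> {mat 1}"
  proof
    assume "T \<subseteq> {mat 1}"
    then have "card T \<le> card {mat 1 :: 'a^2^2}" by (intro card_mono) auto
    then show False using T(2) by simp
  qed
  then obtain A where "A \<in> T" "A \<noteq> mat 1" by blast
  then obtain x where x: "mval z x \<in> T" "x \<noteq> one_mat"
    using mval_surj mval_one by (metis mval_eq_iff)
  then obtain l where l: "l \<in> set T_lists" "x \<in> set l"
    using sylow_trace[OF T x(1)] trace_zero_list by blast
  have "T \<subseteq> sval z l"
  proof
    fix B assume B: "B \<in> T"
    obtain y where y: "B = mval z y" using mval_surj by metis
    have ty: "mtr y = F0" "mdet y = F1" using sylow_trace[OF T] B y by auto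
    then obtain k where k: "k \<in> set T_lists" "y \<in> set k"
      using trace_zero_list by blast
    have "mval z (mmul x y) \<in> T"
      using subgroup.m_closed[OF T(1) x(1) B] by (simp add: y mval_mmul)
    then have "ltr x y = F0" using sylow_trace[OF T] ltr_eq by metis
    moreover have "commute_at l x k"
      using commuting_T l k x(2)
      by (auto simp: all_list_iff commute_list_def commute_elem_def simp del: all_list.simps split: if_splits)
    moreover have "commute_at l x ys \<longleftrightarrow> (\<forall>y\<in>set ys. ltr x y = F0 \<longrightarrow> y \<in> set l)" for ys
      by (induction ys) (auto simp: mem_list_iff)
    ultimately have "y \<in> set l" using k by blast
    then show "B \<in> sval z l" by (simp add: y mval_sval)
  qed
  moreover have "finite (sval z l)" by (simp add: sval_def)
  ultimately have "T = sval z l" using card_sval_T[OF l(1)] T(2) by (metis card_subset_eq)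
  then show "T \<in> sval z ` set T_lists" using l by blast
next
  fix T :: "('a^2^2) set" assume "T \<in> sval z ` set T_lists"
  then obtain l where l: "l \<in> set T_lists" "T = sval z l" by blast
  then have "subgroup T SL2"
    using subgroup_lists subgroup_sval by (simp add: all_list_iff del: all_list.simps)
  then show "T \<in> sylow_subgroups 2 SL2" using l card_sval_T by (simp add: sylow_iff_card)
qed

lemma sylow_conj:
  fixes T :: "('a^2^2) set"
  assumes "T \<in> sylow_subgroups 2 SL2" "x \<in> carrier SL2"
  shows "x <#\<^bsub>SL2\<^esub> T #>\<^bsub>SL2\<^esub> inv\<^bsub>SL2\<^esub> x \<in> sylow_subgroups 2 SL2"
proof -
  have T: "subgroup T SL2" "card T = 8" using assms by (simp_all add: sylow_iff_card)
  have Tc: "T \<subseteq> carrier SL2" using T subgroup.subset by blast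
  have "subgroup (x <#\<^bsub>SL2\<^esub> T #>\<^bsub>SL2\<^esub> inv\<^bsub>SL2\<^esub> x) SL2"
    by (rule SL2.subgroup_conjugation_is_surj2) (fact assms T)+
  moreover have "card (x <#\<^bsub>SL2\<^esub> T #>\<^bsub>SL2\<^esub> inv\<^bsub>SL2\<^esub> x) = card T"
  proof -
    have "x <#\<^bsub>SL2\<^esub> T #>\<^bsub>SL2\<^esub> inv\<^bsub>SL2\<^esub> x =
      (\<lambda>h. x \<otimes>\<^bsub>SL2\<^esub> h \<otimes>\<^bsub>SL2\<^esub> inv\<^bsub>SL2\<^esub> x) ` T"
      by (auto simp: l_coset_def r_coset_def)
    moreover have "inj_on (\<lambda>h. x \<otimes>\<^bsub>SL2\<^esub> h \<otimes>\<^bsub>SL2\<^esub> inv\<^bsub>SL2\<^esub> x) T"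
      using SL2.conjugation_is_inj[OF assms(2)] Tc by (meson inj_onI subsetD)
    ultimately show ?thesis by (simp add: card_image)
  qed
  ultimately show ?thesis using T by (simp add: sylow_iff_card)
qed

lemma Union_sylow: "mdet m = F1 \<Longrightarrow> mval z m \<in> \<Union>(sylow_subgroups 2 SL2) \<longleftrightarrow> mtr m = F0"
proof
  assume "mval z m \<in> \<Union>(sylow_subgroups 2 SL2)"
  then show "mtr m = F0" using sylow_trace by (auto simp: sylow_iff_card)
next
  assume "mdet m = F1" "mtr m = F0"
  then obtain l where "l \<in> set T_lists" "m \<in> set l"
    using trace_zero_list by blast
  then show "mval z m \<in> \<Union>(sylow_subgroups 2 SL2)"
    unfolding sylow_lists using mval_sval by blast
qed

end

section \<open>The geometries given by lists of matrices\<close>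

lemma forced_iff:
  "forced ls B B' \<longleftrightarrow> ((\<forall>l\<in>set ls. set l \<inter> set B' \<noteq> {}) \<longrightarrow> set B' = set B)"
  by (auto simp: forced_def meets_all_iff sub_list_iff)

lemma determined_iff:
  "determined Ss Ds ls B xs \<longleftrightarrow>
     (\<forall>x\<in>set xs. (\<forall>D\<in>set Ds. \<forall>d\<in>set D. forced ls B (rtrans (mmul (minv d) x) D)) \<and>
       (\<forall>S\<in>set Ss. forced ls B (rtrans x S)))"
proof -
  have "forced_at ls B x D ds \<longleftrightarrow> (\<forall>d\<in>set ds. forced ls B (rtrans (mmul (minv d) x) D))" for x D ds
    by (induction ds) auto
  then have "forced_bases ls B x Ds \<longleftrightarrow>
      (\<forall>D\<in>set Ds. \<forall>d\<in>set D. forced ls B (rtrans (mmul (minv d) x) D))" for x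
    by (induction Ds) auto
  moreover have "forced_subs ls B x Ss \<longleftrightarrow> (\<forall>S\<in>set Ss. forced ls B (rtrans x S))" for x
    by (induction Ss) auto
  ultimately show ?thesis by (induction xs) auto
qed

lemma separated_iff:
  "separated ls \<longleftrightarrow> sorted_wrt (\<lambda>l k. \<not> set l \<subseteq> set k) ls"
proof -
  have "not_sub_any l ks \<longleftrightarrow> (\<forall>k\<in>set ks. \<not> set l \<subseteq> set k)" for l ks
    by (induction ks) (auto simp: sub_list_iff)
  then show ?thesis by (induction ls) auto
qed

lemma quot_free_iff:
  "quot_free ds D \<longleftrightarrow>
     (\<forall>d\<in>set ds. mdet d = F1 \<and> (\<forall>k\<in>set D. d = k \<or> ltr (minv d) k \<noteq> F0))"
proof -
  have "quot_free_at d ks \<longleftrightarrow> (\<forall>k\<in>set ks. d = k \<or> ltr (minv d) k \<noteq> F0)" for d ks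
    by (induction ks) auto
  then show ?thesis by (induction ds) auto
qed

text \<open>The subgroup \<open>C_list\<close> is treated as one more base, its right cosets being
  long blocks like any others. It is set apart only where blocks through a given point are listed,
  as a subgroup has just one right coset there.\<close>

locale checked_base = gf8_field z for z :: "'a::field" +
  fixes Ds :: "mat list list" and certs :: "(nat \<times> mat \<times> nat list) list"
  assumes base_ok: "D \<in> set (C_list # Ds) \<Longrightarrow> base_ok D"
    and certs_ok: "c \<in> set certs \<Longrightarrow> cert_ok Ds c"
    and certs_cover: "L \<in> set (C_list # Ds @ T_lists) \<Longrightarrow> covered (map (cert_block Ds) certs) L"
    and flat_ok: "flat_cert Ds"
    and lines_separated: "separated (lines Ds)"
    and nonempty: "Ds \<noteq> []"
begin

abbreviation bases :: "('a^2^2) set set" where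
  "bases \<equiv> sval z ` set (C_list # Ds)"

lemma base_two_elems: "D \<in> set (C_list # Ds) \<Longrightarrow> length D = 9 \<and> D ! 0 \<noteq> D ! 1"
  using base_ok[of D] by (simp add: base_ok_def split: if_splits)

lemma base_quot_free: "D \<in> set (C_list # Ds) \<Longrightarrow> quot_free D D"
  using base_ok[of D] by (simp add: base_ok_def split: if_splits)

lemma base_mdet: "D \<in> set (C_list # Ds) \<Longrightarrow> d \<in> set D \<Longrightarrow> mdet d = F1"
  using base_quot_free quot_free_iff by blast

lemma T_list_one: "l \<in> set T_lists \<Longrightarrow> one_mat \<in> set l"
  using subgroup_lists
  by (auto simp: all_list_iff subgroup_list_def mem_list_iff simp del: all_list.simps split: if_splits)

lemma C_list_one: "one_mat \<in> set C_list"
  by (simp add: C_list_def)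

sublocale coset_geometry SL2 bases "sylow_subgroups 2 SL2"
proof (rule coset_geometry.intro[OF group_SL2 coset_geometry_axioms.intro])
  fix T assume T: "T \<in> sylow_subgroups 2 (SL2 :: ('a^2^2) monoid)"
  then have card: "subgroup T SL2" "card T = 8" by (simp_all add: sylow_iff_card)
  then show "subgroup T SL2" by simp
  show "finite T" using card(2) by (metis card.infinite zero_neq_numeral)
  show "card T = card T'" if "T' \<in> sylow_subgroups 2 SL2" for T' :: "('a^2^2) set"
    using that card by (simp add: sylow_iff_card)
  show "\<exists>t\<in>T. t \<noteq> \<one>\<^bsub>SL2\<^esub>"
  proof (rule ccontr)
    assume "\<not> (\<exists>t\<in>T. t \<noteq> \<one>\<^bsub>SL2\<^esub>)"
    then have "T \<subseteq> {\<one>\<^bsub>SL2\<^esub>}" by blast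
    then have "card T \<le> card {\<one>\<^bsub>SL2\<^esub> :: 'a^2^2}" by (intro card_mono) auto
    then show False using card by simp
  qed
  show "x <#\<^bsub>SL2\<^esub> T #>\<^bsub>SL2\<^esub> inv\<^bsub>SL2\<^esub> x \<in> sylow_subgroups 2 SL2"
    if "x \<in> carrier SL2" for x using sylow_conj T that .
next
  fix D assume "D \<in> bases"
  then obtain l where l: "l \<in> set (C_list # Ds)" "D = sval z l" by blast
  show "D \<subseteq> carrier SL2"
    using base_mdet l mval_carrier by (auto simp: sval_def simp del: SL2_simps)
  have "l ! 0 \<in> set l" "l ! 1 \<in> set l" using base_two_elems[OF l(1)] by auto
  then show "\<exists>d\<in>D. \<exists>d'\<in>D. d \<noteq> d'"
    using base_two_elems[OF l(1)] mval_sval mval_eq_iff l(2) by metis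
next
  fix D d d' T
  assume D: "D \<in> bases" "d \<in> D" "d' \<in> D" and T: "T \<in> sylow_subgroups 2 (SL2 :: ('a^2^2) monoid)"
    and quot: "inv\<^bsub>SL2\<^esub> d \<otimes>\<^bsub>SL2\<^esub> d' \<in> T"
  then obtain l a b where l: "l \<in> set (C_list # Ds)" "a \<in> set l" "b \<in> set l"
    "d = mval z a" "d' = mval z b"
    by (auto simp: sval_def)
  then have "mval z (mmul (minv a) b) \<in> T"
    using quot inv_mval base_mdet by (simp add: mval_mmul)
  moreover have "subgroup T SL2" "card T = 8" using T by (simp_all add: sylow_iff_card)
  ultimately have "ltr (minv a) b = F0" using sylow_trace(1) by (simp only: ltr_eq)
  then have "a = b" using base_quot_free[OF l(1)] l quot_free_iff by blast
  then show "d = d'" using l by simp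
qed

lemma long_blockE':
  assumes "B \<in> long_blocks"
  obtains D y where "D \<in> set (C_list # Ds)" "mdet y = F1" "B = sval z (rtrans y D)"
proof -
  obtain D' x where "D' \<in> bases" "x \<in> carrier SL2" and B: "B = D' #>\<^bsub>SL2\<^esub> x"
    using assms by (rule long_blockE)
  then obtain D y where "D \<in> set (C_list # Ds)" "D' = sval z D" "mdet y = F1" "x = mval z y"
    unfolding carrier_mval by blast
  then show thesis using that sval_r_coset B by blast
qed

lemma long_blockI':
  assumes "D \<in> set (C_list # Ds)" "mdet y = F1"
  shows "sval z (rtrans y D) \<in> long_blocks"
proof -
  have "sval z D \<in> bases" using assms(1) by (rule imageI)
  moreover have "mval z y \<in> carrier SL2" using assms(2) by (simp only: mval_carrier)
  ultimately show ?thesis using long_blockI sval_r_coset by metis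
qed

lemma subgroup_block_through:
  assumes "subgroup_list l" "mdet y = F1" "x \<in> set (rtrans y l)"
  shows "sval z (rtrans y l) = sval z (rtrans x l)"
proof -
  have "subgroup (sval z l) SL2" using assms(1) by (rule subgroup_sval)
  moreover have "mval z y \<in> carrier SL2" using assms(2) by (simp only: mval_carrier)
  moreover have "mval z x \<in> sval z l #>\<^bsub>SL2\<^esub> mval z y"
    using assms(3) mval_sval by (simp only: sval_r_coset)
  ultimately show ?thesis using SL2.r_coset_subgroup_eq by (metis sval_r_coset)
qed

lemma C_subgroup: "subgroup_list C_list" and T_subgroup: "l \<in> set T_lists \<Longrightarrow> subgroup_list l"
  using subgroup_lists by (auto simp: all_list_iff simp del: all_list.simps)

text \<open>From \<open>x = d y\<close> follows \<open>y = (inv d) x\<close>. This removes the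
  unknown translation and leaves the finite list searched by \<open>determined\<close>.\<close>

lemma long_block_through:
  assumes "B \<in> long_blocks" "mval z x \<in> B"
  shows "B = sval z (rtrans x C_list) \<or>
    (\<exists>D\<in>set Ds. \<exists>d\<in>set D. B = sval z (rtrans (mmul (minv d) x) D))"
proof -
  obtain D y where D: "D \<in> set (C_list # Ds)" "mdet y = F1" "B = sval z (rtrans y D)"
    using assms(1) by (rule long_blockE')
  have x: "x \<in> set (rtrans y D)" using assms(2) D(3) mval_sval by simp
  show ?thesis
  proof (cases "D \<in> set Ds")
    case True
    from x obtain d where d: "d \<in> set D" "x = mmul d y" by (auto simp: set_rtrans)
    then have "mmul (minv d) x = y" using base_mdet D(1) mmul_minv by (metis mmul_assoc mmul_one(2))
    then show ?thesis using True d D by metis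
  next
    case False
    then have "D = C_list" using D(1) by simp
    then show ?thesis using subgroup_block_through[OF C_subgroup D(2)] x D(3) by metis
  qed
qed

lemma short_block_through:
  assumes "B \<in> short_blocks" "mval z x \<in> B"
  shows "\<exists>l\<in>set T_lists. B = sval z (rtrans x l)"
proof -
  obtain T y' where "T \<in> sylow_subgroups 2 SL2" "y' \<in> carrier SL2" and B: "B = T #>\<^bsub>SL2\<^esub> y'"
    using assms(1) by (rule short_blockE)
  then obtain l y where l: "l \<in> set T_lists" "T = sval z l" and y: "mdet y = F1" "y' = mval z y"
    unfolding carrier_mval sylow_lists by blast
  then have B': "B = sval z (rtrans y l)" using B sval_r_coset by simp
  then have "x \<in> set (rtrans y l)" using assms(2) mval_sval by simp
  then show ?thesis using subgroup_block_through[OF T_subgroup[OF l(1)] y(1)] B' l(1) by metis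
qed

text \<open>The hypothesis \<open>short\<close> permits \<open>Ss\<close> to omit a Sylow subgroup
  of which \<open>B'\<close> is known not to be a coset, as happens for the class of
  \<open>T3_list\<close>.\<close>

lemma determined_unique:
  assumes det: "determined Ss Ds ls B xs" and C: "C_list \<in> set Ss"
    and B': "B' \<in> long_blocks \<union> short_blocks"
    and short: "\<And>x l. B' = sval z (rtrans x l) \<Longrightarrow> mval z x \<in> B' \<Longrightarrow> l \<in> set T_lists \<Longrightarrow> l \<in> set Ss"
    and xs: "sval z xs \<inter> B' \<noteq> {}" and ls: "\<And>l. l \<in> set ls \<Longrightarrow> sval z l \<inter> B' \<noteq> {}"
  shows "B' = sval z B"
proof -
  obtain x where x: "x \<in> set xs" "mval z x \<in> B'" using xs by (auto simp: sval_def)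
  have "\<exists>k. B' = sval z k \<and> forced ls B k"
  proof (cases "B' \<in> long_blocks")
    case True
    then show ?thesis
      using long_block_through[OF True x(2)] det x(1) C unfolding determined_iff by blast
  next
    case False
    then obtain l where "l \<in> set T_lists" "B' = sval z (rtrans x l)"
      using B' short_block_through x(2) by blast
    then show ?thesis
      using short[of x l] x det unfolding determined_iff by blast
  qed
  then obtain k where k: "B' = sval z k" "forced ls B k" by blast
  moreover have "\<forall>l\<in>set ls. set l \<inter> set k \<noteq> {}" using ls k(1) by (simp add: sval_Int)
  ultimately show ?thesis by (simp add: forced_iff sval_eq_iff)
qed

lemma lines_long:
  assumes "l \<in> set (lines Ds)"
  shows "sval z l \<in> long_blocks" "one_mat \<in> set l"
proof -
  consider "l = C_list" | D d where "D \<in> set Ds" "d \<in> set D" "l = rtrans (minv d) D"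
    using assms by (auto simp: lines_def lines_of_def)
  then have "sval z l \<in> long_blocks \<and> one_mat \<in> set l"
  proof cases
    case 1
    have "sval z (rtrans one_mat C_list) \<in> long_blocks" by (rule long_blockI') simp_all
    moreover have "rtrans one_mat k = k" for k by (induction k) simp_all
    ultimately show ?thesis using 1 C_list_one by simp
  next
    case 2
    then have "mdet d = F1" using base_mdet[of D d] by simp
    then show ?thesis
      using 2 long_blockI'[of D "minv d"] mmul_minv'[of d] by (auto simp: mdet_minv set_rtrans intro: rev_image_eqI)
  qed
  then show "sval z l \<in> long_blocks" "one_mat \<in> set l" by simp_all
qed

lemma certificate_block:
  assumes c: "c \<in> set certs"
  obtains B ls where "cert_block Ds c = B" "sval z B \<in> long_blocks" "one_mat \<notin> set B" "ls \<noteq> []"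
    "set ls \<subseteq> set (lines Ds)" "\<And>l. l \<in> set ls \<Longrightarrow> set l \<inter> set B \<noteq> {}"
    "determined (C_list # T_lists) Ds (map (removeAll one_mat) (tl ls)) B (removeAll one_mat (hd ls))"
proof -
  obtain k y js where c_eq: "c = (k, y, js)" by (cases c)
  let ?ls = "map ((!) (lines Ds)) js" and ?B = "rtrans y (Ds ! k)"
  have "k < length Ds \<and> mdet y = F1 \<and> js \<noteq> [] \<and> (\<forall>j\<in>set js. j < length (lines Ds)) \<and>
      cert_lines_ok Ds ?B ?ls"
    using certs_ok[OF c] by (simp add: c_eq all_list_iff split: if_splits)
  then have k: "k < length Ds" "mdet y = F1" "js \<noteq> []" "\<forall>j\<in>set js. j < length (lines Ds)"
    and lo: "cert_lines_ok Ds ?B ?ls" by blast+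
  show thesis
  proof (rule that)
    show "cert_block Ds c = ?B" by (simp add: c_eq)
    show "sval z ?B \<in> long_blocks" using k by (intro long_blockI') simp_all
    show "one_mat \<notin> set ?B"
      "determined (C_list # T_lists) Ds (map (removeAll one_mat) (tl ?ls)) ?B (removeAll one_mat (hd ?ls))"
      using lo by (simp_all add: cert_lines_ok_def mem_list_iff split: if_splits)
    show "set l \<inter> set ?B \<noteq> {}" if "l \<in> set ?ls" for l
      using lo that unfolding cert_lines_ok_def meets_all_iff by (metis (no_types))
    show "?ls \<noteq> []" using k by simp
    show "set ?ls \<subseteq> set (lines Ds)" using k by auto
  qed
qed

sublocale certified_geometry SL2 bases "sylow_subgroups 2 SL2"
proof unfold_locales
  fix L assume "L \<in> bases \<union> sylow_subgroups 2 SL2"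
  then obtain l where l: "l \<in> set (C_list # Ds @ T_lists)" "L = sval z l"
    unfolding sylow_lists by auto
  obtain d c where d: "d \<in> set l" and c: "c \<in> set certs"
    and meet: "set (cert_block Ds c) \<inter> set (rtrans (minv d) l) \<noteq> {}"
  proof -
    have "\<exists>d\<in>set l. \<exists>c\<in>set certs. set (rtrans (minv d) l) \<inter> set (cert_block Ds c) \<noteq> {} \<or>
        set (cert_block Ds c) \<inter> set (rtrans (minv d) l) \<noteq> {}"
      using certs_cover[OF l(1)] by (simp add: covered_def ex_list_iff lines_of_def meets_iff) blast
    then show thesis using that by (metis Int_commute)
  qed
  obtain B ls where B: "cert_block Ds c = B" "sval z B \<in> long_blocks" "one_mat \<notin> set B"
    and ls: "ls \<noteq> []" "set ls \<subseteq> set (lines Ds)" "\<And>l. l \<in> set ls \<Longrightarrow> set l \<inter> set B \<noteq> {}"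
    and det: "determined (C_list # T_lists) Ds (map (removeAll one_mat) (tl ls)) B (removeAll one_mat (hd ls))"
    using certificate_block[OF c] by blast
  have one_iff: "\<one>\<^bsub>SL2\<^esub> \<in> sval z k \<longleftrightarrow> one_mat \<in> set k" for k
    using mval_sval[of one_mat k] mval_one by (metis SL2_simps(3))
  have md: "mdet d = F1" using l d base_mdet T_mdet by auto
  show "\<exists>d\<in>L. \<exists>B\<in>long_blocks. \<one>\<^bsub>SL2\<^esub> \<notin> B \<and> B \<inter> (L #>\<^bsub>SL2\<^esub> inv\<^bsub>SL2\<^esub> d) \<noteq> {} \<and>
        (\<exists>Ls. Ls \<noteq> {} \<and> Ls \<subseteq> long_blocks \<and> (\<forall>M\<in>Ls. \<one>\<^bsub>SL2\<^esub> \<in> M \<and> M \<inter> B \<noteq> {}) \<and>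
          (\<forall>B'\<in>long_blocks \<union> short_blocks.
            \<one>\<^bsub>SL2\<^esub> \<notin> B' \<and> (\<forall>M\<in>Ls. M \<inter> B' \<noteq> {}) \<longrightarrow> B' = B))"
  proof (intro bexI[of _ "mval z d"] bexI[of _ "sval z B"] conjI exI[of _ "sval z ` set ls"] ballI impI)
    show "\<one>\<^bsub>SL2\<^esub> \<notin> sval z B" using B one_iff by blast
    show "sval z B \<inter> (L #>\<^bsub>SL2\<^esub> inv\<^bsub>SL2\<^esub> (mval z d)) \<noteq> {}"
      using meet B(1) by (simp only: l(2) inv_mval[OF md] sval_r_coset sval_Int not_False_eq_True)
    show "sval z ` set ls \<noteq> {}" using ls(1) by simp
    show "sval z ` set ls \<subseteq> long_blocks" using ls(2) lines_long(1) by blast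
    show "\<one>\<^bsub>SL2\<^esub> \<in> M" if "M \<in> sval z ` set ls" for M
      using that ls(2) lines_long(2) one_iff by blast
    show "M \<inter> sval z B \<noteq> {}" if "M \<in> sval z ` set ls" for M
      using that ls(3) sval_Int by blast
    show "sval z B \<in> long_blocks" by fact
    show "mval z d \<in> L" using d l mval_sval by simp
    fix B' assume B': "B' \<in> long_blocks \<union> short_blocks"
      and meets: "\<one>\<^bsub>SL2\<^esub> \<notin> B' \<and> (\<forall>M\<in>sval z ` set ls. M \<inter> B' \<noteq> {})"
    have rem: "sval z (removeAll one_mat k) \<inter> B' \<noteq> {}" if "k \<in> set ls" for k
    proof -
      have "sval z k \<inter> B' \<noteq> {}" using meets that by blast
      then obtain x where x: "x \<in> set k" "mval z x \<in> B'"
        by (auto simp: sval_def)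
      moreover have "x \<noteq> one_mat" using x meets mval_one by (metis SL2_simps(3))
      ultimately have "mval z x \<in> sval z (removeAll one_mat k) \<inter> B'" by (simp add: mval_sval)
      then show ?thesis by blast
    qed
    show "B' = sval z B"
    proof (rule determined_unique[OF det _ B'])
      show "sval z (removeAll one_mat (hd ls)) \<inter> B' \<noteq> {}" using rem ls(1) by simp
      show "sval z k \<inter> B' \<noteq> {}" if "k \<in> set (map (removeAll one_mat) (tl ls))" for k
        using that rem list.set_sel(2)[OF ls(1)] by auto
    qed simp_all
  qed
next
  have hd: "hd Ds \<in> set (C_list # Ds)" using nonempty by simp
  have fl: "one_mat \<in> set (hd Ds)" "determined (C_list # remove1 T3_list T_lists) Ds
      (map (\<lambda>j. rtrans (hd Ds ! j) T3_list) [1, 2, 8]) (hd Ds) T3_list"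
    using flat_ok by (simp_all add: flat_cert_def mem_list_iff split: if_splits)
  have T3: "T3_list \<in> set T_lists" by (simp add: T_lists_def)
  let ?T = "sval z T3_list"
  \<comment> \<open>The group \<open>?T\<close> joins the three cosets of \<open>flat_cert\<close>:
    there it plays the part of \<open>xs\<close>, the source of candidate points.\<close>
  let ?Ms = "insert ?T ((\<lambda>j. sval z (rtrans (hd Ds ! j) T3_list)) ` {1, 2, 8})"
  have rone: "rtrans one_mat k = k" for k by (induction k) simp_all
  have len: "j < length (hd Ds)" if "j \<in> {1, 2, 8}" for j
    using base_two_elems[OF hd] that by auto
  have coset: "sval z (rtrans y T3_list) \<in> {?T #>\<^bsub>SL2\<^esub> x | x. x \<in> carrier SL2}" if "mdet y = F1" for y
  proof -
    have "mval z y \<in> carrier SL2" using that by (simp only: mval_carrier)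
    then show ?thesis using sval_r_coset by blast
  qed
  have mdet_j: "mdet (hd Ds ! j) = F1" if "j \<in> {1, 2, 8}" for j
    using base_mdet[OF hd] len[OF that] nth_mem by blast
  show "\<exists>T\<in>sylow_subgroups 2 SL2. \<exists>B\<in>long_blocks. \<exists>Ms\<subseteq>{T #>\<^bsub>SL2\<^esub> x | x. x \<in> carrier SL2}.
      (\<forall>M\<in>Ms. M \<inter> B \<noteq> {}) \<and>
      (\<forall>B'\<in>long_blocks \<union> short_blocks. B' \<notin> {T #>\<^bsub>SL2\<^esub> x | x. x \<in> carrier SL2} \<and>
        (\<forall>M\<in>Ms. M \<inter> B' \<noteq> {}) \<longrightarrow> B' = B)"
  proof (rule bexI[of _ ?T], rule bexI[of _ "sval z (hd Ds)"], rule exI[of _ ?Ms],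
      intro conjI ballI impI)
    have "?T \<in> {?T #>\<^bsub>SL2\<^esub> x | x. x \<in> carrier SL2}" using coset[of one_mat] rone by simp
    then show "?Ms \<subseteq> {?T #>\<^bsub>SL2\<^esub> x | x. x \<in> carrier SL2}"
      using coset mdet_j by blast
    show "?T \<in> sylow_subgroups 2 SL2" unfolding sylow_lists using T3 by blast
    show "sval z (hd Ds) \<in> long_blocks" using long_blockI'[OF hd, of one_mat] rone by simp
    show "M \<inter> sval z (hd Ds) \<noteq> {}" if "M \<in> ?Ms" for M
    proof -
      have "set T3_list \<inter> set (hd Ds) \<noteq> {}" using fl(1) T_list_one[OF T3] by blast
      moreover have "set (rtrans (hd Ds ! j) T3_list) \<inter> set (hd Ds) \<noteq> {}" if "j \<in> {1, 2, 8}" for j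
      proof -
        have "hd Ds ! j \<in> set (rtrans (hd Ds ! j) T3_list)"
          using T_list_one[OF T3] by (auto simp: set_rtrans intro: rev_image_eqI)
        then show ?thesis using len[OF that] nth_mem by blast
      qed
      ultimately show ?thesis using that sval_Int by blast
    qed
    fix B' assume B': "B' \<in> long_blocks \<union> short_blocks"
      and m: "B' \<notin> {?T #>\<^bsub>SL2\<^esub> x | x. x \<in> carrier SL2} \<and> (\<forall>M\<in>?Ms. M \<inter> B' \<noteq> {})"
    show "B' = sval z (hd Ds)"
    proof (rule determined_unique[OF fl(2) _ B'])
      show "?T \<inter> B' \<noteq> {}" using m by blast
      show "sval z l \<inter> B' \<noteq> {}" if "l \<in> set (map (\<lambda>j. rtrans (hd Ds ! j) T3_list) [1, 2, 8])" for l
        using that m by auto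
      show "l \<in> set (C_list # remove1 T3_list T_lists)"
        if "B' = sval z (rtrans x l)" "mval z x \<in> B'" "l \<in> set T_lists" for x l
      proof -
        have "mdet x = F1" using that(2) B' block_sub mval_carrier by blast
        \<comment> \<open>Otherwise \<open>B'\<close> would be a right coset of \<open>?T\<close>
          and belong to the excluded class.\<close>
        then have "l \<noteq> T3_list" using that(1) coset m by blast
        then show ?thesis using that(3) by simp
      qed
    qed simp
  qed
qed

lemma count_free_eq: "count_free Ds a = length (filter (free a) (lines Ds))"
proof -
  have "mtr (mmul (mmul k y) a) = mtr (mmul k (mmul y a))" for k y by (simp add: mmul_assoc)
  then have free: "free a (rtrans y D) = free (mmul y a) D" for y D
    by (simp add: free_iff set_rtrans ltr_eq)
  have "count_at a D ds = length (filter (free a) (map (\<lambda>d. rtrans (minv d) D) ds))" for D ds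
    by (induction ds) (simp_all add: free)
  then have "count_bases a Es = length (filter (free a) (concat (map lines_of Es)))" for Es
    by (induction Es) (simp_all add: lines_of_def)
  then show ?thesis by (simp add: count_free_def lines_def)
qed

text \<open>Translation by \<open>a\<close> takes the long blocks through 1 to those through
  \<open>a\<close>, and \<open>lines_separated\<close> ensures that different list entries are
  different blocks.\<close>

lemma card_remote_count:
  assumes a: "mdet a = F1"
  shows "card (remote (mval z a)) = count_free Ds a"
proof -
  have far: "(\<forall>b\<in>sval z (rtrans a l). b \<notin> \<Union>(sylow_subgroups 2 SL2)) \<longleftrightarrow> free a l"
    if "l \<in> set (lines Ds)" for l
  proof -
    have "mdet (mmul k a) = F1" if "k \<in> set l" for k
    proof -
      have "mval z k \<in> carrier SL2"
        using that \<open>l \<in> set (lines Ds)\<close> lines_long(1) long_sub mval_sval by blast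
      then have "mdet k = F1" by (simp only: mval_carrier)
      then show ?thesis using a by (simp add: mdet_mmul)
    qed
    then show ?thesis
      using Union_sylow by (simp add: sval_def set_rtrans free_iff ltr_eq del: Union_iff)
  qed
  have "remote (mval z a) = (\<lambda>l. sval z (rtrans a l)) ` set (filter (free a) (lines Ds))"
  proof (intro equalityI subsetI)
    fix B assume "B \<in> remote (mval z a)"
    then have B: "B \<in> long_blocks" "mval z a \<in> B" "\<forall>b\<in>B. b \<notin> \<Union>(sylow_subgroups 2 SL2)"
      unfolding remote_def by blast+
    have assoc: "rtrans (mmul y a) D = rtrans a (rtrans y D)" for y D
      by (induction D) (simp_all add: mmul_assoc)
    have "\<exists>l\<in>set (lines Ds). B = sval z (rtrans a l)"
      using long_block_through[OF B(1,2)]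
      by (auto simp: assoc lines_def lines_of_def)
    then show "B \<in> (\<lambda>l. sval z (rtrans a l)) ` set (filter (free a) (lines Ds))"
      using far B(3) by auto
  next
    fix B assume "B \<in> (\<lambda>l. sval z (rtrans a l)) ` set (filter (free a) (lines Ds))"
    then obtain l where l: "l \<in> set (lines Ds)" "free a l" "B = sval z (rtrans a l)" by auto
    have "mval z a \<in> carrier SL2" using a by (simp only: mval_carrier)
    then have "B \<in> long_blocks" using l lines_long(1) long_translate sval_r_coset by metis
    moreover have "a \<in> set (rtrans a l)"
      using lines_long(2)[OF l(1)] by (auto simp: set_rtrans intro: rev_image_eqI)
    then have "mval z a \<in> B" using l(3) mval_sval by simp
    ultimately show "B \<in> remote (mval z a)" unfolding remote_def using far l by blast
  qed
  moreover have "inj_on (\<lambda>l. sval z (rtrans a l)) (set (filter (free a) (lines Ds)))"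
  proof (rule inj_onI)
    fix l k assume lk: "l \<in> set (filter (free a) (lines Ds))" "k \<in> set (filter (free a) (lines Ds))"
      and eq: "sval z (rtrans a l) = sval z (rtrans a k)"
    have "mval z a \<in> carrier SL2" using a by (simp only: mval_carrier)
    moreover have "sval z l \<subseteq> carrier SL2" "sval z k \<subseteq> carrier SL2"
      using lk lines_long(1) long_sub by auto
    ultimately have "sval z l = sval z k"
      using eq translate_inverse(1) by (metis sval_r_coset)
    then have s: "set l = set k" by (simp add: sval_eq_iff)
    obtain i j where i: "i < length (lines Ds)" "lines Ds ! i = l"
      and j: "j < length (lines Ds)" "lines Ds ! j = k"
      using lk by (auto simp: in_set_conv_nth)
    \<comment> \<open>Equal sets at two different positions would contradict this, whichever
      position comes first.\<close>
    have "\<not> set (lines Ds ! i) \<subseteq> set (lines Ds ! j)" if "i < j" "j < length (lines Ds)" for i j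
      using lines_separated that by (simp add: separated_iff sorted_wrt_iff_nth_less)
    then have "i = j" using i j s by (metis linorder_less_linear subset_refl)
    then show "l = k" using i j by simp
  qed
  moreover have "distinct (lines Ds)"
    using lines_separated unfolding separated_iff distinct_conv_nth sorted_wrt_iff_nth_less
    by (metis linorder_less_linear subset_refl)
  ultimately show ?thesis
    by (simp add: card_image count_free_eq distinct_card[OF distinct_filter] del: set_filter)
qed

lemma mem_remote_numbers:
  "n \<in> (\<lambda>a. card (remote a)) ` carrier SL2 \<longleftrightarrow> (\<exists>a. mdet a = F1 \<and> count_free Ds a = n)"
proof -
  have "(\<lambda>a. card (remote a)) ` carrier SL2 = count_free Ds ` {a. mdet a = F1}"
    unfolding carrier_mval image_image using card_remote_count by (intro image_cong) simp_all
  then show ?thesis by auto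
qed

end

section \<open>The six closures and their invariants\<close>

context checked_base
begin

lemma affine_U_eq:
  "affine_U (sval z C_list) (sval z ` set Ds) =
     \<lparr>points = carrier SL2, blocks = long_blocks \<union> short_blocks\<rparr>"
proof -
  have "{sval z C_list #>\<^bsub>SL2\<^esub> x | x. x \<in> carrier SL2} \<union>
      {D #>\<^bsub>SL2\<^esub> x | D x. D \<in> sval z ` set Ds \<and> x \<in> carrier SL2} = long_blocks"
    unfolding long_blocks_def by auto
  then show ?thesis unfolding affine_U_def short_blocks_def by blast
qed

lemma flat_par_eq: "flat_par = flat_classes"
  unfolding flat_par_def flat_classes_def ..

lemma natural_par_eq: "natural_par = natural_classes"
  unfolding natural_par_def natural_classes_def ..

lemma closure_invariants:
  assumes U: "U = affine_U (sval z C_list) (sval z ` set Ds)"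
    and \<pi>: "\<pi> = flat_par \<or> \<pi> = natural_par"
  shows "n \<in> remote_numbers (closure_by U \<pi>) \<longleftrightarrow> (\<exists>a. mdet a = F1 \<and> count_free Ds a = n)"
    and "B \<in> blocks (closure_by U \<pi>) \<Longrightarrow> B \<subseteq> points (closure_by U \<pi>)"
proof -
  have *: "closure_by U \<pi> = flat.clos \<or> closure_by U \<pi> = natural.clos"
    using \<pi> unfolding U affine_U_eq flat_par_eq natural_par_eq by blast
  then have "remote_numbers (closure_by U \<pi>) = (\<lambda>a. card (remote a)) ` carrier SL2"
    using remote_numbers by metis
  then show "n \<in> remote_numbers (closure_by U \<pi>) \<longleftrightarrow> (\<exists>a. mdet a = F1 \<and> count_free Ds a = n)"
    by (simp only: mem_remote_numbers)
  show "B \<in> blocks (closure_by U \<pi>) \<Longrightarrow> B \<subseteq> points (closure_by U \<pi>)"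
    using * flat.blocks_clos_sub[of B] natural.blocks_clos_sub[of B] by metis
qed

lemma closure_translational:
  assumes U: "U = affine_U (sval z C_list) (sval z ` set Ds)"
  shows "translational (closure_by U natural_par)" "\<not> translational (closure_by U flat_par)"
  unfolding U affine_U_eq flat_par_eq natural_par_eq
  by (fact translational_natural not_translational_flat)+

end

theorem mainTheorem3:
  fixes z :: "'a::field"
  assumes "CARD('a) = 8"
    and "z ^ 3 = z + 1"
  shows "let Us = [closure_by (WU z) flat_par, closure_by (WU z) natural_par,
                   closure_by (OU z) flat_par, closure_by (OU z) natural_par,
                   closure_by (PU z) flat_par, closure_by (PU z) natural_par]
         in \<forall>i < 6. \<forall>j < 6. i \<noteq> j \<longrightarrow> \<not> isomorphic (Us ! i) (Us ! j)"
proof -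
  interpret gf8_field z using assms by unfold_locales
  interpret W: checked_base z W_base W_certs
    using W_checks W_certs_ok by unfold_locales (simp_all only: list_all_iff, simp add: W_base_def)
  interpret O: checked_base z O_base O_certs
    using O_checks O_certs_ok by unfold_locales (simp_all only: list_all_iff, simp add: O_base_def)
  interpret P: checked_base z P_base P_certs
    using P_checks P_certs_ok by unfold_locales (simp_all only: list_all_iff, simp add: P_base_def)
  \<comment> \<open>In characteristic 2 the matrix \<open>f_con\<close> has determinant 1, so
    conjugation by it takes place inside the group.\<close>
  have g: "mdet g_con = F1" "mdet (mmul g_con g_con) = F1" and f: "mdet f_con = F1" by simp_all
  have g2: "g_mat z [^]\<^bsub>SL2\<^esub> (2::nat) = mval z (mmul g_con g_con)"
    by (simp add: base_vals mval_mmul eval_nat_numeral del: mval.simps mmul.simps)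
  have W: "WU z = affine_U (sval z C_list) (sval z ` set W_base)"
    by (simp add: WU_def W_base_def C_sub_val base_vals sval_frob del: mval.simps)
  have O: "OU z = affine_U (sval z C_list) (sval z ` set O_base)"
    unfolding OU_def g2 unfolding O_base_def C_sub_val base_vals
    by (simp only: sval_conj[OF g(1)] sval_conj[OF g(2)] list.set image_insert image_empty)
  have P: "PU z = affine_U (sval z C_list) (sval z ` set P_base)"
    unfolding PU_def E4'_def g2 unfolding P_base_def C_sub_val base_vals
    by (simp only: sval_conj[OF g(1)] sval_conj[OF g(2)] sval_conj[OF f] list.set image_insert image_empty)
  \<comment> \<open>The first two components identify the affine unital, the third the parallelism.
    Excluding 13 in the second component settles it for \<open>PU\<close> without deciding whether
    24 occurs there.\<close>
  define R where "R I = (13 \<in> remote_numbers I, 13 \<notin> remote_numbers I \<and> 24 \<in> remote_numbers I,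
      translational I)"
    for I :: "('a^2^2 + ('a^2^2) set set) incidence"
  have no13: "13 \<notin> remote_numbers (closure_by (WU z) \<pi>)" "13 \<notin> remote_numbers (closure_by (OU z) \<pi>)"
    and no24: "24 \<notin> remote_numbers (closure_by (OU z) \<pi>)"
    and has13: "13 \<in> remote_numbers (closure_by (PU z) \<pi>)"
    and has24: "24 \<in> remote_numbers (closure_by (WU z) \<pi>)"
    if "\<pi> = flat_par \<or> \<pi> = natural_par" for \<pi>
  proof -
    show "13 \<notin> remote_numbers (closure_by (WU z) \<pi>)"
      unfolding W.closure_invariants(1)[OF W that]
      using W_avoids by (auto simp: all_sl_iff avoids_def)
    show "13 \<notin> remote_numbers (closure_by (OU z) \<pi>)" "24 \<notin> remote_numbers (closure_by (OU z) \<pi>)"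
      unfolding O.closure_invariants(1)[OF O that]
      using O_avoids by (auto simp: all_sl_iff avoids_def)
    show "13 \<in> remote_numbers (closure_by (PU z) \<pi>)"
      unfolding P.closure_invariants(1)[OF P that]
      using P_count by (intro exI[of _ "Mat F0 F2 F5 F2"]) simp
    show "24 \<in> remote_numbers (closure_by (WU z) \<pi>)"
      unfolding W.closure_invariants(1)[OF W that]
      using W_count by (intro exI[of _ "Mat F2 F4 F4 F6"]) simp
  qed
  let ?Us = "[closure_by (WU z) flat_par, closure_by (WU z) natural_par,
              closure_by (OU z) flat_par, closure_by (OU z) natural_par,
              closure_by (PU z) flat_par, closure_by (PU z) natural_par]"
  have R_inv: "\<not> isomorphic I J" if "I \<in> set ?Us" "R I \<noteq> R J" for I J
  proof
    assume iso: "isomorphic I J"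
    from \<open>I \<in> set ?Us\<close> obtain \<pi> where "\<pi> = flat_par \<or> \<pi> = natural_par"
      "I = closure_by (WU z) \<pi> \<or> I = closure_by (OU z) \<pi> \<or> I = closure_by (PU z) \<pi>"
      by (auto simp del: SL2_simps)
    then have sub: "B \<subseteq> points I" if "B \<in> blocks I" for B
      using that W.closure_invariants(2)[OF W] O.closure_invariants(2)[OF O]
        P.closure_invariants(2)[OF P] by metis
    show False
      using isomorphic_invariants[OF iso sub] that(2) by (simp add: R_def)
  qed
  note transl = W.closure_translational[OF W] O.closure_translational[OF O] P.closure_translational[OF P]
  have R_vals: "map R ?Us = [(False, True, False), (False, True, True), (False, False, False),
      (False, False, True), (True, False, False), (True, False, True)]"
    by (simp add: R_def transl no13 no24 has13 has24)
  have "distinct (map R ?Us)" unfolding R_vals by simp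
  then have "R (?Us ! i) \<noteq> R (?Us ! j)" if "i < 6" "j < 6" "i \<noteq> j" for i j
    using nth_eq_iff_index_eq[of "map R ?Us" i j] that by (simp del: list.map nth_Cons_numeral)
  then have "\<not> isomorphic (?Us ! i) (?Us ! j)" if "i < 6" "j < 6" "i \<noteq> j" for i j
    using that by (intro R_inv nth_mem) simp_all
  then show ?thesis unfolding Let_def by blast
qed

end
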